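(* Let $\rho$ be a faithful normal semifinite trace on a von Neumann algebra $\mathfrak{M}$, let $\mathfrak{X}$ be a complex vector space and let $\Phi:\mathfrak{X}\times\mathfrak{X}\to L^2(\rho)$ be a positive sesquilinear map. Then, for all $x,y\in\mathfrak{X}$, $$\|\operatorname{Re}\Phi(x,y)\|_2^2\le\|\Phi(x,x)\|_2\,\|\Phi(y,y)\|_2,\qquad \|\operatorname{Im}\Phi(x,y)\|_2^2\le\|\Phi(x,x)\|_2\,\|\Phi(y,y)\|_2,$$ where $$\operatorname{Re}\Phi(x,y)=\frac{\Phi(x,y)+\Phi(x,y)^*}{2},\qquad \operatorname{Im}\Phi(x,y)=\frac{\Phi(x,y)-\Phi(x,y)^*}{2i}.$$
   Context: For a von Neumann algebra $\mathfrak{M}$ with faithful normal semifinite trace $\rho$, $L^2(\rho)$ is the noncommutative $L^2$-space: the completion of $\{X\in\mathfrak{M}:\rho(|X|^2)<\infty\}$ with respect to $\|X\|_2=\rho(|X|^2)^{1/2}$, where $|X|=(X^*X)^{1/2}$; it carries the operator involution $X\mapsto X^*$, and its elements are identified with operators affiliated with $\mathfrak{M}$. A map $\Phi:\mathfrak{X}\times\mathfrak{X}\to L^2(\rho)$ is sesquilinear if it is linear in the first variable and conjugate-linear in the second; it is positive if $\Phi(x,x)\ge 0$ for every $x\in\mathfrak{X}$. *)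

theory Defs
  imports "HOL-Analysis.Analysis" "HOL-Library.Nonpos_Ints"
begin

section \<open>Complex vector spaces and Hilbert spaces\<close>

class complex_vector = ab_group_add +
  fixes scaleC :: "complex \<Rightarrow> 'a \<Rightarrow> 'a"  (infixr "*\<^sub>C" 75)
  assumes scaleC_add_right: "c *\<^sub>C (x + y) = c *\<^sub>C x + c *\<^sub>C y"
    and scaleC_add_left: "(c + d) *\<^sub>C x = c *\<^sub>C x + d *\<^sub>C x"
    and scaleC_scaleC: "c *\<^sub>C (d *\<^sub>C x) = (c * d) *\<^sub>C x"
    and scaleC_one: "1 *\<^sub>C x = x"

class complex_normed_vector = complex_vector + real_normed_vector +
  assumes scaleR_scaleC: "r *\<^sub>R x = complex_of_real r *\<^sub>C x"
    and norm_scaleC: "norm (c *\<^sub>C x) = cmod c * norm x"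

class complex_inner = complex_normed_vector +
  fixes cinner :: "'a \<Rightarrow> 'a \<Rightarrow> complex"
  assumes cinner_add_left: "cinner (x + y) z = cinner x z + cinner y z"
    and cinner_scaleC_left: "cinner (c *\<^sub>C x) y = c * cinner x y"
    and cinner_commute: "cinner x y = cnj (cinner y x)"
    and cinner_self: "cinner x x = complex_of_real ((norm x)\<^sup>2)"

class chilbert_space = complex_inner + complete_space

definition complex_subspace :: "'a::complex_vector set \<Rightarrow> bool" where
  "complex_subspace S \<longleftrightarrow>
     0 \<in> S \<and> (\<forall>x\<in>S. \<forall>y\<in>S. x + y \<in> S) \<and> (\<forall>c. \<forall>x\<in>S. c *\<^sub>C x \<in> S)"

instantiation prod :: (complex_vector, complex_vector) complex_vector
begin

definition scaleC_prod :: "complex \<Rightarrow> 'a \<times> 'b \<Rightarrow> 'a \<times> 'b" where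
  "c *\<^sub>C p = (c *\<^sub>C fst p, c *\<^sub>C snd p)"

instance
  by standard (simp_all add: scaleC_prod_def prod_eq_iff scaleC_add_right scaleC_add_left
      scaleC_scaleC scaleC_one)

end

lemma bounded_linear_scaleC_right:
  "bounded_linear (\<lambda>x::'a::complex_normed_vector. c *\<^sub>C x)"
  by (rule bounded_linear_intro[where K = "cmod c"])
     (simp_all add: scaleC_add_right scaleR_scaleC scaleC_scaleC norm_scaleC mult.commute)

instantiation blinfun :: (real_normed_vector, complex_normed_vector) complex_normed_vector
begin

lift_definition scaleC_blinfun :: "complex \<Rightarrow> ('a \<Rightarrow>\<^sub>L 'b) \<Rightarrow> ('a \<Rightarrow>\<^sub>L 'b)"
  is "\<lambda>c f x. c *\<^sub>C f x"
  by (rule bounded_linear_compose[OF bounded_linear_scaleC_right])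

instance
proof
  have le: "norm (c *\<^sub>C f) \<le> cmod c * norm f" for c and f :: "'a \<Rightarrow>\<^sub>L 'b"
    by (rule norm_blinfun_bound)
       (auto simp: scaleC_blinfun.rep_eq norm_scaleC mult.assoc intro!: mult_left_mono norm_blinfun)
  fix c d :: complex and r :: real and f g :: "'a \<Rightarrow>\<^sub>L 'b"
  show "c *\<^sub>C (f + g) = c *\<^sub>C f + c *\<^sub>C g"
    by (rule blinfun_eqI) (simp add: scaleC_blinfun.rep_eq blinfun.add_left scaleC_add_right)
  show "(c + d) *\<^sub>C f = c *\<^sub>C f + d *\<^sub>C f"
    by (rule blinfun_eqI) (simp add: scaleC_blinfun.rep_eq blinfun.add_left scaleC_add_left)
  show assoc: "c *\<^sub>C (d *\<^sub>C f) = (c * d) *\<^sub>C f" for c d and f :: "'a \<Rightarrow>\<^sub>L 'b"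
    by (rule blinfun_eqI) (simp add: scaleC_blinfun.rep_eq scaleC_scaleC)
  show one: "1 *\<^sub>C f = f" for f :: "'a \<Rightarrow>\<^sub>L 'b"
    by (rule blinfun_eqI) (simp add: scaleC_blinfun.rep_eq scaleC_one)
  show scR: "r *\<^sub>R f = complex_of_real r *\<^sub>C f" for r and f :: "'a \<Rightarrow>\<^sub>L 'b"
    by (rule blinfun_eqI) (simp add: scaleC_blinfun.rep_eq blinfun.scaleR_left scaleR_scaleC)
  show "norm (c *\<^sub>C f) = cmod c * norm f"
  proof (cases "c = 0")
    case True
    then show ?thesis using le[of c f] by simp
  next
    case False
    have "norm f = norm (inverse c *\<^sub>C (c *\<^sub>C f))"
      using False by (simp add: assoc one)
    also have "\<dots> \<le> cmod (inverse c) * norm (c *\<^sub>C f)"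
      by (rule le)
    finally have "cmod c * norm f \<le> norm (c *\<^sub>C f)"
      using False by (simp add: norm_inverse norm_divide field_simps)
    with le[of c f] show ?thesis by simp
  qed
qed

end


section \<open>Bounded operators\<close>

text \<open>The bounded operators on a complex Hilbert space \<open>'h\<close> are the complex-linear elements of
  the library type \<open>'h \<Rightarrow>\<^sub>L 'h\<close> of bounded real-linear maps.\<close>

type_synonym 'h op = "'h \<Rightarrow>\<^sub>L 'h"

definition bounded_ops :: "'h::chilbert_space op set" where
  "bounded_ops = {A :: 'h op. \<forall>c x. A (c *\<^sub>C x) = c *\<^sub>C A x}"

definition op_adj :: "'h::chilbert_space op \<Rightarrow> 'h op" where
  "op_adj A = (THE B :: 'h op. \<forall>x y. cinner (A x) y = cinner x (B y))"

definition op_pos :: "'h::chilbert_space op \<Rightarrow> bool" where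
  "op_pos A \<longleftrightarrow> A \<in> bounded_ops \<and> (\<forall>x. cinner (A x) x \<in> \<real>\<^sub>\<ge>\<^sub>0)"

definition op_le :: "'h::chilbert_space op \<Rightarrow> 'h op \<Rightarrow> bool" where
  "op_le A B \<longleftrightarrow> op_pos (B - A)"

definition op_abs :: "'h::chilbert_space op \<Rightarrow> 'h op" where
  "op_abs A = (THE P. op_pos P \<and> P o\<^sub>L P = op_adj A o\<^sub>L A)"


section \<open>Von Neumann algebras and traces\<close>

definition commutant :: "'h::chilbert_space op set \<Rightarrow> 'h op set" where
  "commutant M = {A \<in> bounded_ops. \<forall>B\<in>M. A o\<^sub>L B = B o\<^sub>L A}"

definition von_neumann_algebra :: "'h::chilbert_space op set \<Rightarrow> bool" where
  "von_neumann_algebra M \<longleftrightarrow>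
     M \<subseteq> bounded_ops \<and> complex_subspace M \<and>
     (\<forall>A\<in>M. \<forall>B\<in>M. A o\<^sub>L B \<in> M) \<and> (\<forall>A\<in>M. op_adj A \<in> M) \<and>
     commutant (commutant M) = M"

definition pos_part :: "'h::chilbert_space op set \<Rightarrow> 'h op set" where
  "pos_part M = {A \<in> M. op_pos A}"

text \<open>Only the values of a trace on the positive cone of \<open>M\<close> are meaningful.\<close>

definition trace_on :: "'h::chilbert_space op set \<Rightarrow> ('h op \<Rightarrow> ennreal) \<Rightarrow> bool" where
  "trace_on M \<rho> \<longleftrightarrow>
     (\<forall>A\<in>pos_part M. \<forall>B\<in>pos_part M. \<rho> (A + B) = \<rho> A + \<rho> B) \<and>
     (\<forall>A\<in>pos_part M. \<forall>r\<ge>0. \<rho> (r *\<^sub>R A) = ennreal r * \<rho> A) \<and>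
     (\<forall>A\<in>M. \<rho> (op_adj A o\<^sub>L A) = \<rho> (A o\<^sub>L op_adj A))"

definition faithful_trace :: "'h::chilbert_space op set \<Rightarrow> ('h op \<Rightarrow> ennreal) \<Rightarrow> bool" where
  "faithful_trace M \<rho> \<longleftrightarrow> (\<forall>A\<in>pos_part M. \<rho> A = 0 \<longrightarrow> A = 0)"

text \<open>Normality: \<open>\<rho>\<close> preserves suprema of bounded increasing nets, a net being replaced by its
  (upward directed) set of values.\<close>

definition normal_trace :: "'h::chilbert_space op set \<Rightarrow> ('h op \<Rightarrow> ennreal) \<Rightarrow> bool" where
  "normal_trace M \<rho> \<longleftrightarrow>
     (\<forall>D A. D \<noteq> {} \<longrightarrow> D \<subseteq> pos_part M \<longrightarrow>
        (\<forall>X\<in>D. \<forall>Y\<in>D. \<exists>Z\<in>D. op_le X Z \<and> op_le Y Z) \<longrightarrow>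
        A \<in> pos_part M \<longrightarrow> (\<forall>X\<in>D. op_le X A) \<longrightarrow>
        (\<forall>B\<in>pos_part M. (\<forall>X\<in>D. op_le X B) \<longrightarrow> op_le A B) \<longrightarrow>
        \<rho> A = (SUP X\<in>D. \<rho> X))"

definition semifinite_trace :: "'h::chilbert_space op set \<Rightarrow> ('h op \<Rightarrow> ennreal) \<Rightarrow> bool" where
  "semifinite_trace M \<rho> \<longleftrightarrow>
     (\<forall>A\<in>pos_part M. A \<noteq> 0 \<longrightarrow> (\<exists>B\<in>pos_part M. B \<noteq> 0 \<and> op_le B A \<and> \<rho> B < \<infinity>))"


section \<open>Affiliated operators\<close>

text \<open>Unbounded operators are given by their graphs.\<close>

definition closed_densely_defined :: "('h::chilbert_space \<times> 'h) set \<Rightarrow> bool" where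
  "closed_densely_defined T \<longleftrightarrow>
     complex_subspace T \<and> single_valued T \<and> closed T \<and> closure (Domain T) = UNIV"

definition graph_adj :: "('h::chilbert_space \<times> 'h) set \<Rightarrow> ('h \<times> 'h) set" where
  "graph_adj T = {(y, z). \<forall>(x, w)\<in>T. cinner w y = cinner x z}"

definition graph_pos :: "('h::chilbert_space \<times> 'h) set \<Rightarrow> bool" where
  "graph_pos T \<longleftrightarrow> graph_adj T = T \<and> (\<forall>(x, y)\<in>T. cinner y x \<in> \<real>\<^sub>\<ge>\<^sub>0)"

text \<open>\<open>T\<close> is affiliated with \<open>M\<close> if \<open>A T \<subseteq> T A\<close> for every \<open>A\<close> in the commutant of \<open>M\<close>.\<close>

definition affiliated :: "'h::chilbert_space op set \<Rightarrow> ('h \<times> 'h) set \<Rightarrow> bool" where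
  "affiliated M T \<longleftrightarrow>
     closed_densely_defined T \<and> (\<forall>A\<in>commutant M. \<forall>(x, y)\<in>T. (A x, A y) \<in> T)"

definition projections :: "'h::chilbert_space op set \<Rightarrow> 'h op set" where
  "projections M = {P \<in> M. op_adj P = P \<and> P o\<^sub>L P = P}"

text \<open>Nelson's measure topology: \<open>X n\<close> converges to \<open>T\<close> if, eventually, \<open>(X n - T) P\<close> is everywhere
  defined with norm at most \<open>\<epsilon>\<close> for some projection \<open>P\<close> of \<open>M\<close> whose complement has trace at
  most \<open>\<delta>\<close>.\<close>

definition converges_in_measure ::
  "'h::chilbert_space op set \<Rightarrow> ('h op \<Rightarrow> ennreal) \<Rightarrow> (nat \<Rightarrow> 'h op) \<Rightarrow> ('h \<times> 'h) set \<Rightarrow> bool" where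
  "converges_in_measure M \<rho> X T \<longleftrightarrow>
     (\<forall>\<epsilon>>0. \<forall>\<delta>>0. \<exists>N. \<forall>n\<ge>N. \<exists>P\<in>projections M.
        \<rho> (id_blinfun - P) \<le> ennreal \<delta> \<and>
        (\<forall>x. \<exists>y. (P x, y) \<in> T \<and> norm (X n (P x) - y) \<le> \<epsilon> * norm x))"


section \<open>The noncommutative L2 space\<close>

definition square_integrable :: "'h::chilbert_space op set \<Rightarrow> ('h op \<Rightarrow> ennreal) \<Rightarrow> 'h op set" where
  "square_integrable M \<rho> = {X \<in> M. \<rho> (op_abs X o\<^sub>L op_abs X) < \<infinity>}"

definition norm2 :: "('h::chilbert_space op \<Rightarrow> ennreal) \<Rightarrow> 'h op \<Rightarrow> real" where
  "norm2 \<rho> X = sqrt (enn2real (\<rho> (op_abs X o\<^sub>L op_abs X)))"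

text \<open>\<open>L2_completion M \<rho> \<iota>\<close>: the complex Banach space \<open>'l\<close> together with the embedding \<open>\<iota>\<close> of
  the square-integrable elements of \<open>M\<close> is the completion of the latter for \<open>norm2 \<rho>\<close>. This
  determines \<open>'l\<close> and \<open>\<iota>\<close> up to a unique isometric isomorphism, and the norm of \<open>'l\<close> is the
  extension of \<open>norm2 \<rho>\<close>.\<close>

definition L2_completion ::
  "'h::chilbert_space op set \<Rightarrow> ('h op \<Rightarrow> ennreal) \<Rightarrow>
   ('h op \<Rightarrow> 'l::{complex_normed_vector, complete_space}) \<Rightarrow> bool" where
  "L2_completion M \<rho> \<iota> \<longleftrightarrow>
     (\<forall>X\<in>square_integrable M \<rho>. \<forall>Y\<in>square_integrable M \<rho>. \<iota> (X + Y) = \<iota> X + \<iota> Y) \<and>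
     (\<forall>c. \<forall>X\<in>square_integrable M \<rho>. \<iota> (c *\<^sub>C X) = c *\<^sub>C \<iota> X) \<and>
     (\<forall>X\<in>square_integrable M \<rho>. norm (\<iota> X) = norm2 \<rho> X) \<and>
     closure (\<iota> ` square_integrable M \<rho>) = UNIV"

text \<open>The involution of the completion is the continuous extension of \<open>X \<mapsto> X\<^sup>*\<close>.\<close>

definition L2_adj ::
  "'h::chilbert_space op set \<Rightarrow> ('h op \<Rightarrow> ennreal) \<Rightarrow>
   ('h op \<Rightarrow> 'l::{complex_normed_vector, complete_space}) \<Rightarrow> 'l \<Rightarrow> 'l" where
  "L2_adj M \<rho> \<iota> =
     (THE J. continuous_on UNIV J \<and> (\<forall>X\<in>square_integrable M \<rho>. J (\<iota> X) = \<iota> (op_adj X)))"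

text \<open>\<open>L2_operator M \<rho> \<iota> \<xi> T\<close>: the element \<open>\<xi>\<close> of the completion is identified with the affiliated
  operator \<open>T\<close>. Convergence in L2 implies convergence in measure, so \<open>\<xi>\<close> corresponds to the
  common limit in measure of the sequences in \<open>M\<close> that converge to \<open>\<xi>\<close> in L2.\<close>

definition L2_operator ::
  "'h::chilbert_space op set \<Rightarrow> ('h op \<Rightarrow> ennreal) \<Rightarrow>
   ('h op \<Rightarrow> 'l::{complex_normed_vector, complete_space}) \<Rightarrow> 'l \<Rightarrow> ('h \<times> 'h) set \<Rightarrow> bool" where
  "L2_operator M \<rho> \<iota> \<xi> T \<longleftrightarrow>
     affiliated M T \<and>
     (\<exists>X. (\<forall>n. X n \<in> square_integrable M \<rho>) \<and> (\<lambda>n. \<iota> (X n)) \<longlonglongrightarrow> \<xi> \<and>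
          converges_in_measure M \<rho> X T)"

definition L2_pos ::
  "'h::chilbert_space op set \<Rightarrow> ('h op \<Rightarrow> ennreal) \<Rightarrow>
   ('h op \<Rightarrow> 'l::{complex_normed_vector, complete_space}) \<Rightarrow> 'l \<Rightarrow> bool" where
  "L2_pos M \<rho> \<iota> \<xi> \<longleftrightarrow> (\<exists>T. L2_operator M \<rho> \<iota> \<xi> T \<and> graph_pos T)"

definition L2_Re ::
  "'h::chilbert_space op set \<Rightarrow> ('h op \<Rightarrow> ennreal) \<Rightarrow>
   ('h op \<Rightarrow> 'l::{complex_normed_vector, complete_space}) \<Rightarrow> 'l \<Rightarrow> 'l" where
  "L2_Re M \<rho> \<iota> \<xi> = (1 / 2) *\<^sub>C (\<xi> + L2_adj M \<rho> \<iota> \<xi>)"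

definition L2_Im ::
  "'h::chilbert_space op set \<Rightarrow> ('h op \<Rightarrow> ennreal) \<Rightarrow>
   ('h op \<Rightarrow> 'l::{complex_normed_vector, complete_space}) \<Rightarrow> 'l \<Rightarrow> 'l" where
  "L2_Im M \<rho> \<iota> \<xi> = (1 / (2 * \<i>)) *\<^sub>C (\<xi> - L2_adj M \<rho> \<iota> \<xi>)"


section \<open>Sesquilinear maps\<close>

definition sesquilinear :: "('x::complex_vector \<Rightarrow> 'x \<Rightarrow> 'l::complex_vector) \<Rightarrow> bool" where
  "sesquilinear \<Phi> \<longleftrightarrow>
     (\<forall>x y z. \<Phi> (x + y) z = \<Phi> x z + \<Phi> y z) \<and>
     (\<forall>c x y. \<Phi> (c *\<^sub>C x) y = c *\<^sub>C \<Phi> x y) \<and>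
     (\<forall>x y z. \<Phi> x (y + z) = \<Phi> x y + \<Phi> x z) \<and>
     (\<forall>c x y. \<Phi> x (c *\<^sub>C y) = cnj c *\<^sub>C \<Phi> x y)"

end

theory Submission
  imports Defs
begin

text \<open>
  For real \<open>t\<close> and \<open>w \<in> {1, \<i>}\<close> the two elements \<open>\<Phi>(x \<plusminus> t w y, x \<plusminus> t w y)\<close> are positive; they are
  \<open>D \<plusminus> t v\<close> with \<open>D = \<Phi>(x, x) + t\<^sup>2 \<Phi>(y, y)\<close> and \<open>v\<close> equal to twice the real part (\<open>w = 1\<close>) or
  the imaginary part (\<open>w = \<i>\<close>) of \<open>\<Phi>(x, y)\<close>, because \<open>\<Phi>\<close> is Hermitian. Inner products of positive
  elements of \<open>L\<^sup>2\<close> are nonnegative, that is \<open>\<parallel>\<xi> - \<eta>\<parallel> \<le> \<parallel>\<xi> + \<eta>\<parallel>\<close> for positive \<open>\<xi>\<close>, \<open>\<eta>\<close>, so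
  \<open>t \<parallel>v\<parallel> \<le> \<parallel>D\<parallel> \<le> \<parallel>\<Phi>(x, x)\<parallel> + t\<^sup>2 \<parallel>\<Phi>(y, y)\<parallel>\<close>; optimising over \<open>t\<close> gives both inequalities at once
  (\<open>cross_term_bound\<close>).

  It remains to prove two properties of a positive element: it is fixed by the involution, and
  two of them satisfy the norm inequality above. Both pass to \<open>L\<^sup>2\<close> limits, and for positive
  square-integrable operators they are elementary; the norm inequality is the parallelogram law
  together with \<open>\<rho>(A\<^sup>2) + \<rho>(B\<^sup>2) \<le> \<rho>((A + B)\<^sup>2)\<close> (\<open>tr_sq_add_ge\<close>). The heart of the proof is
  therefore \<open>L2_pos_closure\<close>: an element identified with a positive affiliated operator \<open>T\<close> is an
  \<open>L\<^sup>2\<close> limit of positive square-integrable operators. If \<open>X\<close> is close to \<open>T\<close> on the range of a projection \<open>P\<close> with \<open>\<rho>(1 - P)\<close> small,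
  then \<open>P X P\<close> is close in operator norm to the bounded positive operator \<open>P T P\<close>, and still
  \<open>L\<^sup>2\<close>-close to \<open>X\<close>. Multiplying from both sides by a fixed square-integrable approximate unit
  \<open>Y = 1 - (1 - S)\<^sup>m\<close> turns closeness in operator norm into closeness in \<open>L\<^sup>2\<close>. That such \<open>Y\<close>
  approximate is where normality of the trace is needed.

  Two facts about bounded operators carry the rest: the Riesz representation, which provides
  adjoints, and existence and uniqueness of positive square roots, by which the modulus \<open>|X|\<close>
  satisfies \<open>|X|\<^sup>2 = X\<^sup>* X\<close>.
\<close>

section \<open>Hilbert space preliminaries\<close>

instance chilbert_space \<subseteq> banach ..

lemma scaleC_zero_left [simp]: "(0::complex) *\<^sub>C x = 0"
  using scaleC_add_left[of 0 0 x] by simp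

lemma scaleC_zero_right [simp]: "c *\<^sub>C 0 = 0"
  using scaleC_add_right[of c 0 0] by simp

lemma scaleC_minus_one: "(- 1::complex) *\<^sub>C x = - x"
proof -
  have "(- 1::complex) *\<^sub>C x + x = 0"
    using scaleC_add_left[of "-1" 1 x] by (simp add: scaleC_one)
  then show ?thesis by (simp add: eq_neg_iff_add_eq_0)
qed

lemma scaleC_minus_right: "c *\<^sub>C (- x) = - (c *\<^sub>C x)"
  by (metis scaleC_minus_one scaleC_scaleC mult.commute)

lemma scaleC_minus_left: "(- c) *\<^sub>C x = - (c *\<^sub>C x)"
  by (metis scaleC_minus_one scaleC_scaleC mult_minus1)

lemma scaleC_diff_right: "c *\<^sub>C (x - y) = c *\<^sub>C x - c *\<^sub>C y"
  using scaleC_add_right[of c x "- y"] by (simp add: scaleC_minus_right)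

lemma cinner_add_right: "cinner x (y + z) = cinner x y + cinner x z"
  by (metis cinner_commute cinner_add_left complex_cnj_add)

lemma cinner_scaleC_right: "cinner x (c *\<^sub>C y) = cnj c * cinner x y"
  by (metis cinner_commute cinner_scaleC_left complex_cnj_mult)

lemma cinner_minus_left: "cinner (- x) y = - cinner x y"
  using cinner_scaleC_left[of "-1" x y] by (simp add: scaleC_minus_one)

lemma cinner_minus_right: "cinner x (- y) = - cinner x y"
  using cinner_scaleC_right[of x "-1" y] by (simp add: scaleC_minus_one)

lemma cinner_diff_left: "cinner (x - y) z = cinner x z - cinner y z"
  using cinner_add_left[of x "- y" z] by (simp add: cinner_minus_left)

lemma cinner_diff_right: "cinner x (y - z) = cinner x y - cinner x z"
  using cinner_add_right[of x y "- z"] by (simp add: cinner_minus_right)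

lemma cinner_scaleR_left: "cinner (r *\<^sub>R x) y = of_real r * cinner x y"
  by (simp add: scaleR_scaleC cinner_scaleC_left)

lemma cinner_scaleR_right: "cinner x (r *\<^sub>R y) = of_real r * cinner x y"
  by (simp add: scaleR_scaleC cinner_scaleC_right)

lemma cinner_zero_left [simp]: "cinner 0 y = 0"
  using cinner_diff_left[of 0 0 y] by simp

lemma cinner_zero_right [simp]: "cinner x 0 = 0"
  using cinner_diff_right[of x 0 0] by simp

lemmas cinner_simps = cinner_add_left cinner_add_right cinner_diff_left cinner_diff_right
  cinner_minus_left cinner_minus_right cinner_scaleC_left cinner_scaleC_right
  cinner_scaleR_left cinner_scaleR_right

lemma Re_cinner_self: "Re (cinner x x) = (norm x)\<^sup>2"
  by (simp add: cinner_self)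

lemma Re_cinner_commute: "Re (cinner x y) = Re (cinner y x)"
  by (subst cinner_commute) simp

lemma norm_add_square: "(norm (x + y))\<^sup>2 = (norm x)\<^sup>2 + (norm y)\<^sup>2 + 2 * Re (cinner x y)"
  using Re_cinner_commute[of x y]
  by (simp add: Re_cinner_self[symmetric] cinner_simps)

lemma norm_diff_square: "(norm (x - y))\<^sup>2 = (norm x)\<^sup>2 + (norm y)\<^sup>2 - 2 * Re (cinner x y)"
  using norm_add_square[of x "- y"] by (simp add: cinner_simps)

lemma Re_cinner_le: "Re (cinner x y) \<le> norm x * norm y"
proof -
  have "(norm (x + y))\<^sup>2 \<le> (norm x + norm y)\<^sup>2"
    by (intro power_mono norm_triangle_ineq) simp
  then show ?thesis by (simp add: norm_add_square power2_sum)
qed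

lemma abs_Re_cinner_le: "\<bar>Re (cinner x y)\<bar> \<le> norm x * norm y"
  using Re_cinner_le[of x y] Re_cinner_le[of "- x" y] by (simp add: cinner_simps)

lemma Re_cinner_eqI:
  assumes "\<And>y. Re (cinner y u) = Re (cinner y v)"
  shows "u = v"
proof -
  have "Re (cinner (u - v) (u - v)) = 0"
    using assms[of "u - v"] by (simp add: cinner_diff_right)
  then show ?thesis by (simp add: Re_cinner_self)
qed

lemma linear_term_zero:
  fixes a b :: real
  assumes "0 \<le> a" "\<And>t. 0 \<le> t\<^sup>2 * a + 2 * t * b"
  shows "b = 0"
proof (rule ccontr)
  assume b: "b \<noteq> 0"
  define s where "s = 1 / (a + 1)"
  have s: "s > 0" "s * a < 1" using assms(1) by (auto simp: s_def field_simps)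
  have "0 \<le> (- s * b)\<^sup>2 * a + 2 * (- s * b) * b" by (rule assms(2))
  also have "\<dots> = s * b\<^sup>2 * (s * a - 2)" by (simp add: power2_eq_square algebra_simps)
  also have "\<dots> < 0" using s b by (intro mult_pos_neg mult_pos_pos) auto
  finally show False by simp
qed

text \<open>The Riesz vector of \<open>f\<close> is the minimiser of \<open>\<parallel>x\<parallel>\<^sup>2 - 2 f x\<close>: by the parallelogram law a
  minimising sequence is Cauchy, and the first variation at the minimiser is the required
  identity.\<close>

lemma riesz_representation:
  fixes f :: "'h::chilbert_space \<Rightarrow> real"
  assumes f: "bounded_linear f"
  shows "\<exists>z. \<forall>y. f y = Re (cinner y z)"
proof -
  interpret bounded_linear f by fact
  obtain K where K: "\<And>x. \<bar>f x\<bar> \<le> norm x * K"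
    using bounded by (auto simp: real_norm_def)
  define \<phi> where "\<phi> x = (norm x)\<^sup>2 - 2 * f x" for x
  define m where "m = Inf (range \<phi>)"
  have "- (K\<^sup>2) \<le> \<phi> x" for x
  proof -
    have "0 \<le> (norm x - K)\<^sup>2" by simp
    with K[of x] show ?thesis by (simp add: \<phi>_def power2_diff abs_le_iff)
  qed
  then have bdd: "bdd_below (range \<phi>)" by (intro bdd_belowI[of _ "- (K\<^sup>2)"]) auto
  have m: "m \<le> \<phi> x" for x unfolding m_def by (rule cInf_lower[OF _ bdd]) simp
  have "\<exists>x. \<phi> x < m + inverse (real (Suc n))" for n
    using cInf_lessD[of "range \<phi>" "m + inverse (real (Suc n))"] by (auto simp: m_def)
  then obtain X where X: "\<And>n. \<phi> (X n) < m + inverse (real (Suc n))" by metis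
  have gap: "(norm (x - y))\<^sup>2 \<le> 2 * (\<phi> x - m) + 2 * (\<phi> y - m)" for x y
  proof -
    have "m \<le> \<phi> ((1/2) *\<^sub>R (x + y))" by (rule m)
    also have "\<dots> = (norm (x + y))\<^sup>2 / 4 - f x - f y"
      by (simp add: \<phi>_def scaleR add power_mult_distrib power_divide add_divide_distrib del: scaleR_add_right)
    finally show ?thesis
      by (simp add: \<phi>_def norm_add_square norm_diff_square field_simps)
  qed
  have "Cauchy X"
  proof (rule CauchyI)
    fix e :: real assume e: "0 < e"
    then obtain N where N: "inverse (real (Suc N)) < e\<^sup>2 / 4"
      using reals_Archimedean[of "e\<^sup>2 / 4"] by auto
    have small: "\<phi> (X n) - m < e\<^sup>2 / 4" if "n \<ge> N" for n
    proof -
      have "inverse (real (Suc n)) \<le> inverse (real (Suc N))" using that by simp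
      with X[of n] N show ?thesis by linarith
    qed
    have "norm (X i - X j) < e" if "i \<ge> N" "j \<ge> N" for i j
    proof -
      have "(norm (X i - X j))\<^sup>2 < e\<^sup>2"
        using gap[of "X i" "X j"] small[OF that(1)] small[OF that(2)] by simp
      then show ?thesis using e by (simp add: power_less_imp_less_base)
    qed
    then show "\<exists>M. \<forall>i\<ge>M. \<forall>j\<ge>M. norm (X i - X j) < e" by blast
  qed
  then obtain z where z: "X \<longlonglongrightarrow> z" using Cauchy_convergent convergentD by blast
  have "(\<lambda>n. \<phi> (X n)) \<longlonglongrightarrow> \<phi> z"
    unfolding \<phi>_def by (intro tendsto_intros tendsto z)
  moreover have "(\<lambda>n. m + inverse (real (Suc n))) \<longlonglongrightarrow> m + 0"
    by (intro tendsto_intros LIMSEQ_inverse_real_of_nat)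
  ultimately have "\<phi> z \<le> m"
    using LIMSEQ_le[of "\<lambda>n. \<phi> (X n)" "\<phi> z" "\<lambda>n. m + inverse (real (Suc n))" m] X
    by (auto intro: less_imp_le)
  then have minimal: "\<phi> z \<le> \<phi> x" for x using m[of x] by simp
  have "f y = Re (cinner y z)" for y
  proof -
    have "Re (cinner z y) - f y = 0"
    proof (rule linear_term_zero[where a = "(norm y)\<^sup>2"])
      show "0 \<le> t\<^sup>2 * (norm y)\<^sup>2 + 2 * t * (Re (cinner z y) - f y)" for t
        using minimal[of "z + t *\<^sub>R y"]
        by (simp add: \<phi>_def norm_add_square add scaleR cinner_simps power_mult_distrib algebra_simps)
    qed simp
    then show ?thesis using Re_cinner_commute[of z y] by simp
  qed
  then show ?thesis by blast
qed

section \<open>Adjoints and positive operators\<close>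

lemma blinfun_compose_assoc: "(A o\<^sub>L B) o\<^sub>L C = A o\<^sub>L (B o\<^sub>L C)"
  by (rule blinfun_eqI) simp

lemma id_blinfun_compose [simp]: "id_blinfun o\<^sub>L A = A" "A o\<^sub>L id_blinfun = A"
  by (rule blinfun_eqI, simp)+

lemma cinner_eq_by_Re:
  assumes "\<And>c. Re (cinner (c *\<^sub>C x) y) = Re (cinner (c *\<^sub>C u) v)"
  shows "cinner x y = cinner u v"
  using assms[of 1] assms[of "\<i>"] by (simp add: complex_eq_iff cinner_simps)

lemma bounded_opsD: "A \<in> bounded_ops \<Longrightarrow> A (c *\<^sub>C x) = c *\<^sub>C A x"
  by (simp add: bounded_ops_def)

lemma op_adj_eqI:
  fixes A B :: "'h::chilbert_space op"
  assumes "\<And>x y. cinner (A x) y = cinner x (B y)"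
  shows "op_adj A = B"
  unfolding op_adj_def
proof (rule the_equality)
  show "\<forall>x y. cinner (A x) y = cinner x (B y)" using assms by blast
  fix C :: "'h op" assume "\<forall>x y. cinner (A x) y = cinner x (C y)"
  then show "C = B"
    by (intro blinfun_eqI Re_cinner_eqI) (metis assms)
qed

lemma op_adj_exists:
  fixes A :: "'h::chilbert_space op"
  assumes A: "A \<in> bounded_ops"
  shows "\<exists>B\<in>bounded_ops. \<forall>x y. cinner (A x) y = cinner x (B y)"
proof -
  have "\<exists>w. \<forall>y. Re (cinner (A y) z) = Re (cinner y w)" for z
  proof (rule riesz_representation)
    show "bounded_linear (\<lambda>y. Re (cinner (A y) z))"
    proof (rule bounded_linear_intro[where K = "norm A * norm z"])
      show "norm (Re (cinner (A x) z)) \<le> norm x * (norm A * norm z)" for x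
        using order_trans[OF abs_Re_cinner_le[of "A x" z] mult_right_mono[OF norm_blinfun]]
        by (simp add: ac_simps)
    qed (simp_all add: blinfun.bilinear_simps cinner_simps)
  qed
  then obtain b where b: "\<And>z y. Re (cinner (A y) z) = Re (cinner y (b z))" by metis
  have adj: "cinner (A x) y = cinner x (b y)" for x y
    by (rule cinner_eq_by_Re) (simp add: b[symmetric] bounded_opsD[OF A])
  have uniq: "b z = w" if "\<And>y. cinner (A y) z = cinner y w" for z w
    by (rule Re_cinner_eqI) (metis adj that)
  have "bounded_linear b"
  proof (rule bounded_linear_intro[where K = "norm A"])
    show "b (x + y) = b x + b y" for x y
      by (rule uniq) (simp add: adj cinner_simps)
    show "b (r *\<^sub>R x) = r *\<^sub>R b x" for r x
      by (rule uniq) (simp add: adj cinner_simps)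
    show "norm (b x) \<le> norm x * norm A" for x
    proof -
      have "norm (b x) * norm (b x) = Re (cinner (A (b x)) x)"
        by (simp add: adj Re_cinner_self power2_eq_square)
      also have "\<dots> \<le> norm (A (b x)) * norm x" by (rule Re_cinner_le)
      also have "\<dots> \<le> norm A * norm (b x) * norm x"
        by (intro mult_right_mono norm_blinfun) simp
      finally have "norm (b x) * norm (b x) \<le> norm (b x) * (norm x * norm A)"
        by (simp add: ac_simps)
      then show ?thesis
        by (cases "norm (b x) = 0") (simp_all add: mult_le_cancel_left)
    qed
  qed
  then have B: "blinfun_apply (Blinfun b) = b" by (rule bounded_linear_Blinfun_apply)
  have "Blinfun b \<in> bounded_ops"
    by (auto simp: bounded_ops_def B adj cinner_simps intro!: uniq)
  then show ?thesis using adj B by force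
qed

lemma op_adj_bounded_ops: "A \<in> bounded_ops \<Longrightarrow> op_adj A \<in> bounded_ops"
  using op_adj_exists op_adj_eqI by metis

lemma cinner_op_adj: "A \<in> bounded_ops \<Longrightarrow> cinner (A x) y = cinner x (op_adj A y)"
  using op_adj_exists op_adj_eqI by metis

lemma cinner_op_adj': "A \<in> bounded_ops \<Longrightarrow> cinner (op_adj A x) y = cinner x (A y)"
  by (metis cinner_op_adj cinner_commute)

lemma bounded_ops_intros:
  fixes A B :: "'h::chilbert_space op"
  assumes "A \<in> bounded_ops" "B \<in> bounded_ops"
  shows "A + B \<in> bounded_ops" "A - B \<in> bounded_ops" "A o\<^sub>L B \<in> bounded_ops"
  using assms
  by (auto simp: bounded_ops_def blinfun.bilinear_simps scaleC_add_right scaleC_diff_right)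

lemma bounded_ops_scale:
  fixes A :: "'h::chilbert_space op"
  assumes "A \<in> bounded_ops"
  shows "c *\<^sub>C A \<in> bounded_ops" "r *\<^sub>R A \<in> bounded_ops"
  using assms
  by (auto simp: bounded_ops_def scaleC_blinfun.rep_eq scaleR_scaleC scaleC_scaleC mult.commute)

lemma id_bounded_ops [simp]: "id_blinfun \<in> bounded_ops"
  by (simp add: bounded_ops_def)

lemma op_adj_op_adj: "A \<in> bounded_ops \<Longrightarrow> op_adj (op_adj A) = A"
  by (rule op_adj_eqI) (simp add: cinner_op_adj')

lemma op_adj_algebra:
  fixes A B :: "'h::chilbert_space op"
  assumes "A \<in> bounded_ops" "B \<in> bounded_ops"
  shows "op_adj (A + B) = op_adj A + op_adj B" "op_adj (A - B) = op_adj A - op_adj B"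
    "op_adj (A o\<^sub>L B) = op_adj B o\<^sub>L op_adj A"
  by (rule op_adj_eqI; simp add: assms cinner_op_adj blinfun.bilinear_simps cinner_simps)+

lemma op_adj_scale:
  fixes A :: "'h::chilbert_space op"
  assumes "A \<in> bounded_ops"
  shows "op_adj (c *\<^sub>C A) = cnj c *\<^sub>C op_adj A" "op_adj (r *\<^sub>R A) = r *\<^sub>R op_adj A"
  by (rule op_adj_eqI; simp add: assms cinner_op_adj blinfun.bilinear_simps cinner_simps
      scaleC_blinfun.rep_eq)+

lemma op_adj_id [simp]: "op_adj id_blinfun = id_blinfun"
  by (rule op_adj_eqI) simp

text \<open>An operator with real quadratic form is symmetric: polarise over \<open>x + c y\<close> for
  \<open>c = 1, \<i>\<close>.\<close>

lemma op_adj_op_pos: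
  assumes "op_pos A"
  shows "op_adj A = A"
proof (rule op_adj_eqI)
  have A: "A \<in> bounded_ops" and real: "\<And>x. Im (cinner (A x) x) = 0"
    using assms by (auto simp: op_pos_def complex_nonneg_Reals_iff)
  fix x y
  have flip: "cinner x (A y) = cnj (cinner (A y) x)" by (rule cinner_commute)
  have "Im (cinner (A x) y + cinner (A y) x) = 0"
    using real[of "x + y"] real[of x] real[of y]
    by (simp add: blinfun.bilinear_simps cinner_simps)
  moreover have "Re (cinner (A x) y) = Re (cinner (A y) x)"
    using real[of "x + \<i> *\<^sub>C y"] real[of x] real[of y]
    by (simp add: blinfun.bilinear_simps cinner_simps bounded_opsD[OF A])
  ultimately show "cinner (A x) y = cinner x (A y)"
    by (simp add: flip complex_eq_iff)
qed

lemma op_pos_bounded_ops: "op_pos A \<Longrightarrow> A \<in> bounded_ops"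
  by (simp add: op_pos_def)

lemma op_pos_Re: "op_pos A \<Longrightarrow> 0 \<le> Re (cinner (A x) x)"
  by (simp add: op_pos_def complex_nonneg_Reals_iff)

lemma op_posI:
  assumes "A \<in> bounded_ops" "op_adj A = A" "\<And>x. 0 \<le> Re (cinner (A x) x)"
  shows "op_pos A"
proof -
  have "Im (cinner (A x) x) = 0" for x
  proof -
    have "cinner (A x) x = cinner x (A x)" using cinner_op_adj[OF assms(1)] assms(2) by simp
    also have "\<dots> = cnj (cinner (A x) x)" by (rule cinner_commute)
    finally show ?thesis by (simp add: complex_eq_iff)
  qed
  then show ?thesis using assms by (simp add: op_pos_def complex_nonneg_Reals_iff)
qed

lemma op_pos_add: "op_pos A \<Longrightarrow> op_pos B \<Longrightarrow> op_pos (A + B)"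
  by (rule op_posI)
    (simp_all add: op_pos_bounded_ops bounded_ops_intros op_adj_algebra op_adj_op_pos
      blinfun.bilinear_simps cinner_simps op_pos_Re)

lemma op_pos_scaleR: "op_pos A \<Longrightarrow> 0 \<le> r \<Longrightarrow> op_pos (r *\<^sub>R A)"
  by (rule op_posI)
    (simp_all add: op_pos_bounded_ops bounded_ops_scale op_adj_scale op_adj_op_pos
      blinfun.bilinear_simps cinner_simps op_pos_Re)

lemma op_pos_conjugate:
  assumes "op_pos A" "B \<in> bounded_ops"
  shows "op_pos (op_adj B o\<^sub>L A o\<^sub>L B)"
proof (rule op_posI)
  note A = op_pos_bounded_ops[OF assms(1)]
  note mems = A assms(2) op_adj_bounded_ops[OF assms(2)] bounded_ops_intros(3)
  show "op_adj B o\<^sub>L A o\<^sub>L B \<in> bounded_ops" by (simp add: mems)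
  show "op_adj (op_adj B o\<^sub>L A o\<^sub>L B) = op_adj B o\<^sub>L A o\<^sub>L B"
    by (simp add: mems op_adj_algebra op_adj_op_adj op_adj_op_pos[OF assms(1)]
        blinfun_compose_assoc)
  show "0 \<le> Re (cinner ((op_adj B o\<^sub>L A o\<^sub>L B) x) x)" for x
    by (simp add: cinner_op_adj' assms op_pos_Re)
qed

lemma op_pos_id [simp]: "op_pos id_blinfun"
  by (rule op_posI) (simp_all add: Re_cinner_self)

lemma op_pos_adj_compose: "B \<in> bounded_ops \<Longrightarrow> op_pos (op_adj B o\<^sub>L B)"
  using op_pos_conjugate[OF op_pos_id] by simp

lemma norm_op_adj: 
  fixes A :: "'h::chilbert_space op"
  assumes "A \<in> bounded_ops"
  shows "norm (op_adj A) = norm A"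
proof -
  have le: "norm (op_adj B) \<le> norm B" if B: "B \<in> bounded_ops" for B :: "'h op"
  proof (rule norm_blinfun_bound)
    fix x
    let ?v = "op_adj B x"
    have "norm ?v * norm ?v = Re (cinner (B ?v) x)"
      by (simp add: cinner_op_adj[OF B] Re_cinner_self power2_eq_square)
    also have "\<dots> \<le> norm (B ?v) * norm x" by (rule Re_cinner_le)
    also have "\<dots> \<le> norm B * norm ?v * norm x"
      by (intro mult_right_mono norm_blinfun) simp
    finally have "norm ?v * norm ?v \<le> norm ?v * (norm B * norm x)"
      by (simp add: ac_simps)
    then show "norm ?v \<le> norm B * norm x"
      by (cases "norm ?v = 0") (simp_all add: mult_le_cancel_left)
  qed simp
  show ?thesis
    using le[OF assms] le[OF op_adj_bounded_ops[OF assms]] by (simp add: op_adj_op_adj assms)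
qed

text \<open>This is \<open>A\<^sup>2 \<le> K A\<close>: evaluate the form of \<open>A\<close> at \<open>x - (1 / K) A x\<close>.\<close>

lemma norm_op_pos_square_le:
  assumes pos: "op_pos A" and K: "norm A \<le> K"
  shows "(norm (A x))\<^sup>2 \<le> K * Re (cinner (A x) x)"
proof (cases "K = 0")
  case True
  then show ?thesis using K by simp
next
  case False
  then have K0: "K > 0" using K norm_ge_zero[of A] by linarith
  note A = op_pos_bounded_ops[OF pos]
  let ?t = "1 / K"
  have sym: "cinner (A (A x)) x = cinner (A x) (A x)"
    using cinner_op_adj[OF A] op_adj_op_pos[OF pos] by simp
  have "0 \<le> Re (cinner (A (x - ?t *\<^sub>R A x)) (x - ?t *\<^sub>R A x))"
    by (rule op_pos_Re[OF pos])
  also have "\<dots> = Re (cinner (A x) x) - 2 * ?t * (norm (A x))\<^sup>2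
      + ?t\<^sup>2 * Re (cinner (A (A x)) (A x))"
    by (simp add: blinfun.bilinear_simps cinner_simps sym Re_cinner_self power2_eq_square
        algebra_simps)
  also have "\<dots> \<le> Re (cinner (A x) x) - 2 * ?t * (norm (A x))\<^sup>2 + ?t\<^sup>2 * (K * (norm (A x))\<^sup>2)"
  proof -
    have "Re (cinner (A (A x)) (A x)) \<le> norm (A (A x)) * norm (A x)" by (rule Re_cinner_le)
    also have "\<dots> \<le> (K * norm (A x)) * norm (A x)"
      by (intro mult_right_mono order_trans[OF norm_blinfun] K) simp_all
    finally show ?thesis by (intro add_left_mono mult_left_mono) (simp_all add: power2_eq_square)
  qed
  also have "\<dots> = Re (cinner (A x) x) - (norm (A x))\<^sup>2 / K"
    using K0 by (simp add: power2_eq_square field_simps)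
  finally show ?thesis using K0 by (simp add: field_simps)
qed

section \<open>Square roots of positive operators\<close>

lemmas compose_simps =
  bounded_bilinear.add_left[OF bounded_bilinear_blinfun_compose]
  bounded_bilinear.add_right[OF bounded_bilinear_blinfun_compose]
  bounded_bilinear.diff_left[OF bounded_bilinear_blinfun_compose]
  bounded_bilinear.diff_right[OF bounded_bilinear_blinfun_compose]
  bounded_bilinear.scaleR_left[OF bounded_bilinear_blinfun_compose]
  bounded_bilinear.scaleR_right[OF bounded_bilinear_blinfun_compose]
  bounded_bilinear.minus_left[OF bounded_bilinear_blinfun_compose]
  bounded_bilinear.minus_right[OF bounded_bilinear_blinfun_compose]
  bounded_bilinear.zero_left[OF bounded_bilinear_blinfun_compose]
  bounded_bilinear.zero_right[OF bounded_bilinear_blinfun_compose]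

lemma norm_blinfun_compose_mono:
  "norm A \<le> a \<Longrightarrow> norm B \<le> b \<Longrightarrow> norm (A o\<^sub>L B) \<le> a * b"
  by (rule order_trans[OF norm_blinfun_compose])
    (rule mult_mono, auto intro: order_trans[OF norm_ge_zero])

lemma bounded_ops_limit:
  fixes Z :: "nat \<Rightarrow> 'h::chilbert_space op"
  assumes "\<And>n. Z n \<in> bounded_ops" "Z \<longlonglongrightarrow> A"
  shows "A \<in> bounded_ops"
proof -
  have lim: "(\<lambda>n. Z n x) \<longlonglongrightarrow> A x" for x
    by (intro blinfun.tendsto assms tendsto_const)
  have "A (c *\<^sub>C x) = c *\<^sub>C A x" for c x
  proof (rule LIMSEQ_unique)
    show "(\<lambda>n. Z n (c *\<^sub>C x)) \<longlonglongrightarrow> A (c *\<^sub>C x)" by (rule lim)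
    show "(\<lambda>n. Z n (c *\<^sub>C x)) \<longlonglongrightarrow> c *\<^sub>C A x"
      using bounded_linear.tendsto[OF bounded_linear_scaleC_right lim, of c x]
      by (simp add: bounded_opsD[OF assms(1)])
  qed
  then show ?thesis by (simp add: bounded_ops_def)
qed

lemma op_adj_limit:
  fixes Z :: "nat \<Rightarrow> 'h::chilbert_space op"
  assumes mem: "\<And>n. Z n \<in> bounded_ops" and lim: "Z \<longlonglongrightarrow> A"
  shows "(\<lambda>n. op_adj (Z n)) \<longlonglongrightarrow> op_adj A"
proof -
  have A: "A \<in> bounded_ops" by (rule bounded_ops_limit[OF assms])
  have "norm (op_adj (Z n) - op_adj A) = norm (Z n - A)" for n
    using norm_op_adj[OF bounded_ops_intros(2)[OF mem A]] by (simp add: op_adj_algebra mem A)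
  then show ?thesis using lim by (simp add: LIMSEQ_iff)
qed

lemma norm_id_diff_op_pos_le:
  fixes S :: "'h::chilbert_space op"
  assumes pos: "op_pos S" and "norm S \<le> 1"
  shows "norm (id_blinfun - S) \<le> 1"
proof (rule norm_blinfun_bound)
  fix x
  have "(norm (x - S x))\<^sup>2 \<le> (norm x)\<^sup>2"
    using norm_op_pos_square_le[OF assms, of x] op_pos_Re[OF pos, of x] Re_cinner_commute[of x "S x"]
    by (simp add: norm_diff_square)
  then show "norm ((id_blinfun - S) x) \<le> 1 * norm x"
    by (simp add: blinfun.bilinear_simps abs_le_square_iff[symmetric])
qed simp

lemma op_pos_id_diff:
  fixes Z :: "'h::chilbert_space op"
  assumes "Z \<in> bounded_ops" "op_adj Z = Z" "norm Z \<le> 1"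
  shows "op_pos (id_blinfun - Z)"
proof (rule op_posI)
  fix x
  have "Re (cinner (Z x) x) \<le> norm (Z x) * norm x" by (rule Re_cinner_le)
  also have "\<dots> \<le> norm x * norm x"
    using order_trans[OF norm_blinfun mult_right_mono[OF assms(3) norm_ge_zero]]
    by (intro mult_right_mono) auto
  finally show "0 \<le> Re (cinner ((id_blinfun - Z) x) x)"
    by (simp add: blinfun.bilinear_simps cinner_simps Re_cinner_self power2_eq_square)
qed (simp_all add: assms bounded_ops_intros op_adj_algebra)

text \<open>Writing \<open>S = 1 - T\<close> with \<open>\<parallel>T\<parallel> \<le> 1\<close> and \<open>R = 1 - Z\<close>, the equation \<open>R\<^sup>2 = S\<close> is the fixed
  point equation \<open>Z = (T + Z\<^sup>2) / 2\<close>. Its iterates starting from \<open>0\<close> are dominated, together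
  with their increments, by those of the scalar iteration for \<open>T = 1\<close>, which increases to
  its limit; so they converge in norm, inside the closed algebra generated by \<open>T\<close>.\<close>

lemma op_sqrt_exists_contraction:
  fixes S :: "'h::chilbert_space op"
  assumes pos: "op_pos S" and norm_S: "norm S \<le> 1"
  shows "\<exists>R. op_pos R \<and> R o\<^sub>L R = S \<and> (\<forall>B. B o\<^sub>L S = S o\<^sub>L B \<longrightarrow> B o\<^sub>L R = R o\<^sub>L B)"
proof -
  define T where "T = id_blinfun - S"
  have norm_T: "norm T \<le> 1" unfolding T_def by (rule norm_id_diff_op_pos_le[OF assms])
  note S = op_pos_bounded_ops[OF pos]
  have T: "T \<in> bounded_ops" "op_adj T = T"
    by (simp_all add: T_def bounded_ops_intros S op_adj_algebra op_adj_op_pos[OF pos])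
  define Z where "Z n = ((\<lambda>X. (1/2) *\<^sub>R (T + (X o\<^sub>L X))) ^^ n) 0" for n
  define z :: "nat \<Rightarrow> real" where "z n = ((\<lambda>x. (1/2) * (1 + x\<^sup>2)) ^^ n) 0" for n
  have Z0: "Z 0 = 0" and ZS: "Z (Suc n) = (1/2) *\<^sub>R (T + (Z n o\<^sub>L Z n))" for n
    by (simp_all add: Z_def)
  have z0: "z 0 = 0" and zS: "z (Suc n) = (1/2) * (1 + (z n)\<^sup>2)" for n
    by (simp_all add: z_def)
  have z_bounds: "0 \<le> z n \<and> z n \<le> 1" for n
    by (induction n) (simp_all add: z0 zS power_le_one)
  have z_mono: "z n \<le> z (Suc n)" for n
  proof -
    have "0 \<le> (1 - z n)\<^sup>2" by simp
    then show ?thesis by (simp add: zS power2_diff)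
  qed
  have Z_mem: "Z n \<in> bounded_ops \<and> op_adj (Z n) = Z n" for n
  proof (induction n)
    case 0
    show ?case by (simp add: Z0 bounded_ops_def op_adj_eqI)
  next
    case (Suc n)
    then show ?case
      by (simp add: ZS bounded_ops_intros bounded_ops_scale op_adj_algebra op_adj_scale T)
  qed
  have Z_comm: "B o\<^sub>L Z n = Z n o\<^sub>L B" if "B o\<^sub>L T = T o\<^sub>L B" for B n
  proof (induction n)
    case 0
    show ?case by (simp add: Z0 compose_simps)
  next
    case (Suc n)
    then show ?case
      using that by (simp add: ZS compose_simps) (metis blinfun_compose_assoc)
  qed
  have Z_ZS: "Z (Suc n) o\<^sub>L Z n = Z n o\<^sub>L Z (Suc n)" for n
    by (rule Z_comm) (rule Z_comm[symmetric], simp)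
  have norm_Z: "norm (Z n) \<le> z n" for n
  proof (induction n)
    case (Suc n)
    have "norm (T + (Z n o\<^sub>L Z n)) \<le> 1 + z n * z n"
      by (intro norm_triangle_mono norm_T norm_blinfun_compose_mono Suc)
    then show ?case by (simp add: ZS zS power2_eq_square)
  qed (simp add: Z0 z0)
  have step: "norm (Z (Suc n) - Z n) \<le> z (Suc n) - z n" for n
  proof (induction n)
    case 0
    show ?case using norm_T by (simp add: Z0 ZS z0 zS compose_simps)
  next
    case (Suc n)
    have "Z (Suc (Suc n)) - Z (Suc n)
        = (1/2) *\<^sub>R ((Z (Suc n) - Z n) o\<^sub>L (Z (Suc n) + Z n))"
      using Z_ZS[of n] unfolding ZS[of "Suc n"]
      by (subst (3) ZS) (simp add: compose_simps algebra_simps)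
    also have "norm \<dots> \<le> (1/2) * ((z (Suc n) - z n) * (z (Suc n) + z n))"
      using norm_blinfun_compose_mono[OF Suc norm_triangle_mono[OF norm_Z norm_Z]] by simp
    also have "\<dots> = z (Suc (Suc n)) - z (Suc n)"
    proof -
      have "(z (Suc n) - z n) * (z (Suc n) + z n) = (z (Suc n))\<^sup>2 - (z n)\<^sup>2"
        by (simp add: power2_eq_square algebra_simps)
      moreover have "z (Suc (Suc n)) - z (Suc n)
          = (1/2) * (1 + (z (Suc n))\<^sup>2) - (1/2) * (1 + (z n)\<^sup>2)"
        by (rule arg_cong2[of _ _ _ _ minus]) (rule zS)+
      ultimately show ?thesis by (simp add: algebra_simps)
    qed
    finally show ?case .
  qed
  have diff: "norm (Z (n + k) - Z n) \<le> z (n + k) - z n" for n k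
  proof (induction k)
    case (Suc k)
    have "norm (Z (n + Suc k) - Z n)
        \<le> norm (Z (Suc (n + k)) - Z (n + k)) + norm (Z (n + k) - Z n)"
      using norm_triangle_ineq[of "Z (Suc (n + k)) - Z (n + k)" "Z (n + k) - Z n"] by simp
    with Suc step[of "n + k"] show ?case by simp
  qed simp
  have "incseq z" using z_mono by (rule incseq_SucI)
  then have "convergent z"
    using z_bounds incseq_convergent[of z 1] convergentI by metis
  then have "Cauchy z" by (rule convergent_Cauchy)
  have "Cauchy Z"
  proof (rule CauchyI')
    fix e :: real assume "0 < e"
    then obtain N where N: "\<And>m n. m \<ge> N \<Longrightarrow> n \<ge> N \<Longrightarrow> norm (z m - z n) < e"
      using CauchyD[OF \<open>Cauchy z\<close>] by metis
    have "dist (Z m) (Z n) < e" if "m \<ge> N" "n > m" for m n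
      using diff[of m "n - m"] N[of n m] that
      by (simp add: dist_norm norm_minus_commute)
    then show "\<exists>M. \<forall>m\<ge>M. \<forall>n>m. dist (Z m) (Z n) < e" by blast
  qed
  then obtain Y where Y: "Z \<longlonglongrightarrow> Y" using Cauchy_convergent convergentD by blast
  have Y_mem: "Y \<in> bounded_ops" using bounded_ops_limit[OF _ Y] Z_mem by blast
  have Y_adj: "op_adj Y = Y"
    using LIMSEQ_unique[OF op_adj_limit[OF _ Y] ] Z_mem Y by simp
  have "norm (Z n) \<le> 1" for n using norm_Z[of n] z_bounds[of n] by linarith
  then have norm_Y: "norm Y \<le> 1"
    by (intro LIMSEQ_le_const2[OF tendsto_norm[OF Y]]) blast
  have "(\<lambda>n. Z (Suc n)) \<longlonglongrightarrow> (1/2) *\<^sub>R (T + (Y o\<^sub>L Y))"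
    unfolding ZS
    by (intro tendsto_intros bounded_bilinear.tendsto[OF bounded_bilinear_blinfun_compose] Y)
  then have "Y = (1/2) *\<^sub>R (T + (Y o\<^sub>L Y))"
    using LIMSEQ_unique LIMSEQ_Suc[OF Y] by blast
  then have "2 *\<^sub>R Y = 2 *\<^sub>R ((1/2) *\<^sub>R (T + (Y o\<^sub>L Y)))" by (rule arg_cong)
  then have fixed: "Y + Y = T + (Y o\<^sub>L Y)" by (simp add: scaleR_2)
  show ?thesis
  proof (intro exI[of _ "id_blinfun - Y"] conjI allI impI)
    show "op_pos (id_blinfun - Y)" by (rule op_pos_id_diff[OF Y_mem Y_adj norm_Y])
    have "(id_blinfun - Y) o\<^sub>L (id_blinfun - Y) = id_blinfun - (Y + Y) + (Y o\<^sub>L Y)"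
      by (simp add: compose_simps algebra_simps)
    also have "\<dots> = S" by (simp add: fixed T_def)
    finally show "(id_blinfun - Y) o\<^sub>L (id_blinfun - Y) = S" .
    fix B assume "B o\<^sub>L S = S o\<^sub>L B"
    then have BT: "B o\<^sub>L T = T o\<^sub>L B" by (simp add: T_def compose_simps)
    have "(\<lambda>n. B o\<^sub>L Z n) \<longlonglongrightarrow> (B o\<^sub>L Y)" "(\<lambda>n. Z n o\<^sub>L B) \<longlonglongrightarrow> (Y o\<^sub>L B)"
      by (intro bounded_bilinear.tendsto[OF bounded_bilinear_blinfun_compose] Y tendsto_const)+
    then have "B o\<^sub>L Y = Y o\<^sub>L B"
      unfolding Z_comm[OF BT] by (rule LIMSEQ_unique)
    then show "B o\<^sub>L (id_blinfun - Y) = (id_blinfun - Y) o\<^sub>L B"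
      by (simp add: compose_simps)
  qed
qed

lemma op_sqrt_exists:
  fixes S :: "'h::chilbert_space op"
  assumes pos: "op_pos S"
  shows "\<exists>R. op_pos R \<and> R o\<^sub>L R = S \<and> (\<forall>B. B o\<^sub>L S = S o\<^sub>L B \<longrightarrow> B o\<^sub>L R = R o\<^sub>L B)"
proof -
  define k where "k = 1 + norm S"
  have k: "k > 0" by (simp add: k_def add_pos_nonneg)
  have "op_pos ((1/k) *\<^sub>R S)" "norm ((1/k) *\<^sub>R S) \<le> 1"
    using k by (auto intro: op_pos_scaleR pos simp: k_def)
  from op_sqrt_exists_contraction[OF this] obtain R where R: "op_pos R"
    "R o\<^sub>L R = (1/k) *\<^sub>R S"
    and comm: "\<And>B. B o\<^sub>L (1/k) *\<^sub>R S = (1/k) *\<^sub>R S o\<^sub>L B \<Longrightarrow> B o\<^sub>L R = R o\<^sub>L B"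
    by blast
  show ?thesis
  proof (intro exI[of _ "sqrt k *\<^sub>R R"] conjI allI impI)
    show "op_pos (sqrt k *\<^sub>R R)" by (intro op_pos_scaleR R) (use k in simp)
    show "(sqrt k *\<^sub>R R) o\<^sub>L (sqrt k *\<^sub>R R) = S"
      using k by (simp add: compose_simps R)
    fix B assume "B o\<^sub>L S = S o\<^sub>L B"
    then have "B o\<^sub>L R = R o\<^sub>L B" by (intro comm) (simp only: compose_simps)
    then show "B o\<^sub>L (sqrt k *\<^sub>R R) = (sqrt k *\<^sub>R R) o\<^sub>L B"
      by (simp only: compose_simps)
  qed
qed

lemma op_pos_zero_form:
  assumes "op_pos A" "Re (cinner (A x) x) = 0"
  shows "A x = 0"
  using norm_op_pos_square_le[OF assms(1) order_refl, of x] assms(2) by simp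

text \<open>If \<open>A\<close> and \<open>R\<close> are positive square roots of the same operator that commute, then
  \<open>(A + R)(A - R) = 0\<close>, so both forms vanish at \<open>d = (A - R) x\<close> and hence \<open>(A - R) d = 0\<close>.\<close>

lemma commuting_sqrts_eq:
  assumes A: "op_pos A" and R: "op_pos R" and sq: "A o\<^sub>L A = R o\<^sub>L R"
    and comm: "A o\<^sub>L R = R o\<^sub>L A"
  shows "A = R"
proof (rule blinfun_eqI)
  fix x
  note mem = op_pos_bounded_ops[OF A] op_pos_bounded_ops[OF R]
  define d where "d = (A - R) x"
  have "A (A x) = R (R x)" "A (R x) = R (A x)"
    using arg_cong[OF sq, of "\<lambda>B. blinfun_apply B x"]
      arg_cong[OF comm, of "\<lambda>B. blinfun_apply B x"] by simp_all
  then have "A d + R d = 0" by (simp add: d_def blinfun.bilinear_simps)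
  then have "Re (cinner (A d) d) + Re (cinner (R d) d) = 0"
    by (metis cinner_add_left cinner_zero_left plus_complex.simps(1) zero_complex.simps(1))
  with op_pos_Re[OF A, of d] op_pos_Re[OF R, of d]
  have "A d = 0" "R d = 0" by (auto intro!: op_pos_zero_form A R)
  then have "(A - R) d = 0" by (simp add: blinfun.bilinear_simps)
  moreover have "cinner d d = cinner ((A - R) d) x"
    using cinner_op_adj[OF bounded_ops_intros(2)[OF mem]]
    by (simp add: d_def op_adj_algebra mem op_adj_op_pos A R)
  ultimately have "d = 0" using Re_cinner_self[of d] by simp
  then show "A x = R x" by (simp add: d_def blinfun.bilinear_simps)
qed

definition op_sqrt :: "'h::chilbert_space op \<Rightarrow> 'h op" where
  "op_sqrt S = (THE R. op_pos R \<and> R o\<^sub>L R = S)"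

lemma op_sqrt:
  assumes "op_pos S"
  shows "op_pos (op_sqrt S)" "op_sqrt S o\<^sub>L op_sqrt S = S"
    "B o\<^sub>L S = S o\<^sub>L B \<Longrightarrow> B o\<^sub>L op_sqrt S = op_sqrt S o\<^sub>L B"
proof -
  obtain R where R: "op_pos R" "R o\<^sub>L R = S"
    and comm: "\<And>B. B o\<^sub>L S = S o\<^sub>L B \<Longrightarrow> B o\<^sub>L R = R o\<^sub>L B"
    using op_sqrt_exists[OF assms] by blast
  have eq: "op_sqrt S = R" unfolding op_sqrt_def
  proof (rule the_equality)
    fix A assume "op_pos A \<and> A o\<^sub>L A = S"
    then have A: "op_pos A" and sq: "A o\<^sub>L A = S" by simp_all
    have "A o\<^sub>L S = S o\<^sub>L A" by (simp only: sq[symmetric] blinfun_compose_assoc)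
    then have "A o\<^sub>L R = R o\<^sub>L A" by (rule comm)
    moreover have "A o\<^sub>L A = R o\<^sub>L R" by (simp only: sq R(2))
    ultimately show "A = R" by (intro commuting_sqrts_eq[OF A R(1)])
  qed (use R in blast)
  show "op_pos (op_sqrt S)" "op_sqrt S o\<^sub>L op_sqrt S = S"
    unfolding eq by (fact R)+
  show "B o\<^sub>L op_sqrt S = op_sqrt S o\<^sub>L B" if "B o\<^sub>L S = S o\<^sub>L B"
    unfolding eq using that by (rule comm)
qed

lemma op_abs_square:
  assumes "X \<in> bounded_ops"
  shows "op_abs X o\<^sub>L op_abs X = op_adj X o\<^sub>L X"
  unfolding op_abs_def
  by (rule op_sqrt(2)[OF op_pos_adj_compose[OF assms], unfolded op_sqrt_def])

section \<open>Traces and square-integrable elements\<close>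

locale von_neumann =
  fixes M :: "'h::chilbert_space op set"
  assumes von_neumann: "von_neumann_algebra M"
begin

lemma M_bounded: "A \<in> M \<Longrightarrow> A \<in> bounded_ops"
  using von_neumann by (auto simp: von_neumann_algebra_def)

lemma M_closed:
  assumes "A \<in> M" "B \<in> M"
  shows "A + B \<in> M" "A o\<^sub>L B \<in> M"
  using von_neumann assms by (auto simp: von_neumann_algebra_def complex_subspace_def)

lemma M_scale: "A \<in> M \<Longrightarrow> c *\<^sub>C A \<in> M" "A \<in> M \<Longrightarrow> r *\<^sub>R A \<in> M"
  using von_neumann by (auto simp: von_neumann_algebra_def complex_subspace_def scaleR_scaleC)

lemma M_adj: "A \<in> M \<Longrightarrow> op_adj A \<in> M"
  using von_neumann by (auto simp: von_neumann_algebra_def)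

lemma M_diff: "A \<in> M \<Longrightarrow> B \<in> M \<Longrightarrow> A - B \<in> M"
  using M_closed(1)[of A "(- 1) *\<^sub>R B"] M_scale(2)[of B "- 1"] by simp

lemma M_bicommutantI:
  assumes "A \<in> bounded_ops" "\<And>B. B \<in> commutant M \<Longrightarrow> A o\<^sub>L B = B o\<^sub>L A"
  shows "A \<in> M"
  using von_neumann assms unfolding von_neumann_algebra_def by (auto simp: commutant_def)

lemma M_id: "id_blinfun \<in> M"
  by (rule M_bicommutantI) simp_all

lemma M_op_sqrt:
  assumes "A \<in> M" "op_pos A"
  shows "op_sqrt A \<in> M"
proof (rule M_bicommutantI)
  show "op_sqrt A \<in> bounded_ops" by (rule op_pos_bounded_ops[OF op_sqrt(1)[OF assms(2)]])
  fix B assume "B \<in> commutant M"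
  then have "B o\<^sub>L A = A o\<^sub>L B" using assms(1) by (simp add: commutant_def)
  then show "op_sqrt A o\<^sub>L B = B o\<^sub>L op_sqrt A" by (rule op_sqrt(3)[OF assms(2), symmetric])
qed

lemmas M_intros = M_closed M_scale M_adj M_diff M_id

lemma pos_part_adj_compose: "X \<in> M \<Longrightarrow> op_adj X o\<^sub>L X \<in> pos_part M"
  by (simp add: pos_part_def M_intros op_pos_adj_compose M_bounded)

lemma pos_part_add: "A \<in> pos_part M \<Longrightarrow> B \<in> pos_part M \<Longrightarrow> A + B \<in> pos_part M"
  by (simp add: pos_part_def M_intros op_pos_add)

lemma pos_part_scaleR: "A \<in> pos_part M \<Longrightarrow> 0 \<le> r \<Longrightarrow> r *\<^sub>R A \<in> pos_part M"
  by (simp add: pos_part_def M_intros op_pos_scaleR)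

lemma pos_part_adj: "A \<in> pos_part M \<Longrightarrow> op_adj A = A"
  by (simp add: pos_part_def op_adj_op_pos)

lemma pos_part_M: "A \<in> pos_part M \<Longrightarrow> A \<in> M"
  by (simp add: pos_part_def)

lemma pos_part_op_pos: "A \<in> pos_part M \<Longrightarrow> op_pos A"
  by (simp add: pos_part_def)

end

locale von_neumann_trace = von_neumann M
  for M :: "'h::chilbert_space op set" +
  fixes \<rho> :: "'h op \<Rightarrow> ennreal"
  assumes trace: "trace_on M \<rho>"
begin

lemma rho_add: "A \<in> pos_part M \<Longrightarrow> B \<in> pos_part M \<Longrightarrow> \<rho> (A + B) = \<rho> A + \<rho> B"
  using trace by (simp add: trace_on_def)

lemma rho_scaleR: "A \<in> pos_part M \<Longrightarrow> 0 \<le> r \<Longrightarrow> \<rho> (r *\<^sub>R A) = ennreal r * \<rho> A"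
  using trace by (simp add: trace_on_def)

lemma rho_mono:
  assumes "A \<in> pos_part M" "B \<in> pos_part M" "op_pos (B - A)"
  shows "\<rho> A \<le> \<rho> B"
proof -
  have "B - A \<in> pos_part M" using assms by (simp add: pos_part_def M_intros)
  from rho_add[OF assms(1) this] show ?thesis by simp
qed

definition tr_sq :: "'h op \<Rightarrow> ennreal" where
  "tr_sq X = \<rho> (op_adj X o\<^sub>L X)"

lemma tr_sq_pos_part: "A \<in> pos_part M \<Longrightarrow> tr_sq A = \<rho> (A o\<^sub>L A)"
  by (simp add: tr_sq_def pos_part_adj)

lemma tr_sq_adj: "X \<in> M \<Longrightarrow> tr_sq (op_adj X) = tr_sq X"
  using trace by (simp add: trace_on_def tr_sq_def op_adj_op_adj M_bounded)

lemma tr_sq_scaleR: "X \<in> M \<Longrightarrow> tr_sq (r *\<^sub>R X) = ennreal (r\<^sup>2) * tr_sq X"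
  using rho_scaleR[OF pos_part_adj_compose, of X "r\<^sup>2"]
  by (simp add: tr_sq_def op_adj_scale M_bounded compose_simps power2_eq_square)

lemma tr_sq_mono:
  assumes "X \<in> M" "Y \<in> M" "\<And>x. norm (Y x) \<le> norm (X x)"
  shows "tr_sq Y \<le> tr_sq X"
  unfolding tr_sq_def
proof (rule rho_mono)
  note mem = M_bounded[OF assms(1)] M_bounded[OF assms(2)]
  show "op_pos ((op_adj X o\<^sub>L X) - (op_adj Y o\<^sub>L Y))"
  proof (rule op_posI)
    show "0 \<le> Re (cinner (((op_adj X o\<^sub>L X) - (op_adj Y o\<^sub>L Y)) x) x)" for x
      using assms(3)[of x]
      by (simp add: blinfun.bilinear_simps cinner_simps cinner_op_adj' mem Re_cinner_self
          power_mono)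
  qed (simp_all add: mem bounded_ops_intros op_adj_bounded_ops op_adj_algebra op_adj_op_adj)
qed (simp_all add: assms pos_part_adj_compose)

lemma tr_sq_mult_left:
  assumes "B \<in> M" "X \<in> M" "norm B \<le> K"
  shows "tr_sq (B o\<^sub>L X) \<le> ennreal (K\<^sup>2) * tr_sq X"
proof -
  have K: "0 \<le> K" using norm_ge_zero assms(3) by (rule order_trans)
  have "tr_sq (B o\<^sub>L X) \<le> tr_sq (K *\<^sub>R X)"
  proof (rule tr_sq_mono)
    show "norm ((B o\<^sub>L X) x) \<le> norm ((K *\<^sub>R X) x)" for x
      using order_trans[OF norm_blinfun mult_right_mono[OF assms(3)]] K
      by (simp add: blinfun.bilinear_simps)
  qed (simp_all add: assms M_intros)
  then show ?thesis by (simp add: tr_sq_scaleR assms)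
qed

lemma tr_sq_mult_right:
  assumes "B \<in> M" "X \<in> M" "norm B \<le> K"
  shows "tr_sq (X o\<^sub>L B) \<le> ennreal (K\<^sup>2) * tr_sq X"
proof -
  have "tr_sq (X o\<^sub>L B) = tr_sq (op_adj (X o\<^sub>L B))" by (simp add: tr_sq_adj assms M_intros)
  also have "\<dots> = tr_sq (op_adj B o\<^sub>L op_adj X)" by (simp add: op_adj_algebra M_bounded assms)
  also have "\<dots> \<le> ennreal (K\<^sup>2) * tr_sq (op_adj X)"
    by (rule tr_sq_mult_left) (simp_all add: assms M_intros norm_op_adj M_bounded)
  finally show ?thesis by (simp add: tr_sq_adj assms)
qed

lemma tr_sq_parallelogram:
  assumes "X \<in> M" "Y \<in> M"
  shows "tr_sq (X + Y) + tr_sq (X - Y) = 2 * tr_sq X + 2 * tr_sq Y"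
proof -
  note mem = M_bounded[OF assms(1)] M_bounded[OF assms(2)]
  let ?x = "op_adj X o\<^sub>L X" and ?y = "op_adj Y o\<^sub>L Y"
  have "tr_sq (X + Y) + tr_sq (X - Y)
      = \<rho> ((op_adj (X + Y) o\<^sub>L (X + Y)) + (op_adj (X - Y) o\<^sub>L (X - Y)))"
    unfolding tr_sq_def by (rule rho_add[symmetric]) (simp_all add: assms pos_part_adj_compose M_intros)
  also have "(op_adj (X + Y) o\<^sub>L (X + Y)) + (op_adj (X - Y) o\<^sub>L (X - Y))
      = 2 *\<^sub>R ?x + 2 *\<^sub>R ?y"
    by (simp add: op_adj_algebra mem compose_simps scaleR_2)
  also have "\<rho> \<dots> = ennreal 2 * \<rho> ?x + ennreal 2 * \<rho> ?y"
    by (subst rho_add) (simp_all add: rho_scaleR pos_part_scaleR pos_part_adj_compose assms)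
  finally show ?thesis by (simp add: tr_sq_def)
qed

lemma square_integrable_iff: "X \<in> square_integrable M \<rho> \<longleftrightarrow> X \<in> M \<and> tr_sq X < \<infinity>"
  by (auto simp: square_integrable_def tr_sq_def op_abs_square M_bounded)

lemma square_integrable_M: "X \<in> square_integrable M \<rho> \<Longrightarrow> X \<in> M"
  by (simp add: square_integrable_iff)

lemma norm2_eq: "X \<in> M \<Longrightarrow> norm2 \<rho> X = sqrt (enn2real (tr_sq X))"
  by (simp add: norm2_def tr_sq_def op_abs_square M_bounded)

lemma square_integrable_mult_left:
  assumes "B \<in> M" "X \<in> square_integrable M \<rho>"
  shows "B o\<^sub>L X \<in> square_integrable M \<rho>"
  using tr_sq_mult_left[of B X "norm B"] assms
  by (auto simp: square_integrable_iff M_intros ennreal_mult_less_top elim!: order.strict_trans1)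

lemma square_integrable_mult_right:
  assumes "B \<in> M" "X \<in> square_integrable M \<rho>"
  shows "X o\<^sub>L B \<in> square_integrable M \<rho>"
  using tr_sq_mult_right[of B X "norm B"] assms
  by (auto simp: square_integrable_iff M_intros ennreal_mult_less_top elim!: order.strict_trans1)

lemma square_integrable_add:
  assumes "X \<in> square_integrable M \<rho>" "Y \<in> square_integrable M \<rho>"
  shows "X + Y \<in> square_integrable M \<rho>"
proof -
  have "tr_sq (X + Y) \<le> 2 * tr_sq X + 2 * tr_sq Y"
    using assms tr_sq_parallelogram[of X Y] by (metis square_integrable_M le_iff_add)
  also have "\<dots> < \<infinity>" using assms by (simp add: square_integrable_iff ennreal_mult_less_top)
  finally show ?thesis using assms by (simp add: square_integrable_iff M_intros)
qed

lemma square_integrable_scaleC: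
  assumes "X \<in> square_integrable M \<rho>"
  shows "c *\<^sub>C X \<in> square_integrable M \<rho>"
proof -
  have "c *\<^sub>C X = (c *\<^sub>C id_blinfun) o\<^sub>L X"
    by (rule blinfun_eqI) (simp add: scaleC_blinfun.rep_eq)
  then show ?thesis using assms by (simp add: square_integrable_mult_left M_intros)
qed

lemma square_integrable_scaleR:
  "X \<in> square_integrable M \<rho> \<Longrightarrow> r *\<^sub>R X \<in> square_integrable M \<rho>"
  by (simp add: scaleR_scaleC square_integrable_scaleC)

lemma square_integrable_diff:
  assumes "X \<in> square_integrable M \<rho>" "Y \<in> square_integrable M \<rho>"
  shows "X - Y \<in> square_integrable M \<rho>"
  using square_integrable_add[OF assms(1) square_integrable_scaleR[OF assms(2), of "- 1"]]
  by simp

lemma square_integrable_adj: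
  "X \<in> square_integrable M \<rho> \<Longrightarrow> op_adj X \<in> square_integrable M \<rho>"
  by (simp add: square_integrable_iff tr_sq_adj M_intros)

text \<open>Cross terms are nonnegative: with \<open>s = A + B\<close>, \<open>a = \<surd>A\<close>, \<open>b = \<surd>B\<close>, \<open>r = \<surd>s\<close>,
  cyclicity gives \<open>\<rho>(s\<^sup>2) = \<rho>(r a a r) + \<rho>(r b b r) = \<rho>(a s a) + \<rho>(b s b)\<close>, and
  \<open>a s a \<ge> a A a = A\<^sup>2\<close>. Splitting this way keeps every argument of \<open>\<rho>\<close> in the positive
  cone, unlike expanding \<open>(A + B)\<^sup>2\<close>.\<close>

lemma tr_sq_add_ge:
  assumes A: "A \<in> pos_part M" and B: "B \<in> pos_part M"
  shows "tr_sq A + tr_sq B \<le> tr_sq (A + B)"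
proof -
  define s where "s = A + B"
  define r where "r = op_sqrt s"
  have s: "s \<in> pos_part M" unfolding s_def by (rule pos_part_add[OF A B])
  have sqrt_pos: "op_sqrt C \<in> pos_part M" if "C \<in> pos_part M" for C
    using that by (simp add: pos_part_def M_op_sqrt op_sqrt(1))
  have sqrt_sq: "op_sqrt C o\<^sub>L op_sqrt C = C" if "C \<in> pos_part M" for C
    by (rule op_sqrt(2)[OF pos_part_op_pos[OF that]])
  have r: "r \<in> pos_part M" "r o\<^sub>L r = s" unfolding r_def by (simp_all only: sqrt_pos sqrt_sq s)
  have conj: "r o\<^sub>L C o\<^sub>L r = op_adj (op_sqrt C o\<^sub>L r) o\<^sub>L (op_sqrt C o\<^sub>L r)"
    if C: "C \<in> pos_part M" for C
  proof -
    have "op_adj (op_sqrt C o\<^sub>L r) o\<^sub>L (op_sqrt C o\<^sub>L r)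
        = r o\<^sub>L (op_sqrt C o\<^sub>L op_sqrt C) o\<^sub>L r"
      by (simp add: op_adj_algebra pos_part_adj sqrt_pos C r(1) M_bounded pos_part_M
          blinfun_compose_assoc)
    then show ?thesis by (simp only: sqrt_sq C)
  qed
  have cyc: "\<rho> (r o\<^sub>L C o\<^sub>L r) = \<rho> (op_sqrt C o\<^sub>L s o\<^sub>L op_sqrt C)" if C: "C \<in> pos_part M" for C
  proof -
    let ?c = "op_sqrt C"
    have mem: "?c \<in> M" "r \<in> M" by (simp_all add: pos_part_M sqrt_pos C r(1))
    have "\<rho> (r o\<^sub>L C o\<^sub>L r) = tr_sq (?c o\<^sub>L r)" by (simp add: conj C tr_sq_def)
    also have "\<dots> = tr_sq (op_adj (?c o\<^sub>L r))" by (simp add: tr_sq_adj mem M_intros)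
    also have "\<dots> = \<rho> (?c o\<^sub>L (r o\<^sub>L r) o\<^sub>L ?c)"
      by (simp add: tr_sq_def op_adj_algebra op_adj_op_adj op_adj_bounded_ops mem M_bounded
          pos_part_adj sqrt_pos C r(1) blinfun_compose_assoc)
    finally show ?thesis by (simp only: r(2))
  qed
  have ge: "tr_sq C \<le> \<rho> (r o\<^sub>L C o\<^sub>L r)"
    if C: "C \<in> pos_part M" and D: "D \<in> pos_part M" and sum: "s = C + D" for C D
  proof -
    let ?c = "op_sqrt C"
    have c: "?c \<in> pos_part M" by (simp add: sqrt_pos C)
    have sandwich: "?c o\<^sub>L E o\<^sub>L ?c \<in> pos_part M" if "E \<in> pos_part M" for E
      using that op_pos_conjugate[of E ?c] c
      by (simp add: pos_part_def M_intros op_adj_op_pos op_pos_bounded_ops)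
    have CC: "?c o\<^sub>L C o\<^sub>L ?c = C o\<^sub>L C"
    proof -
      have "?c o\<^sub>L (?c o\<^sub>L ?c) o\<^sub>L ?c = (?c o\<^sub>L ?c) o\<^sub>L (?c o\<^sub>L ?c)"
        by (simp only: blinfun_compose_assoc)
      then show ?thesis by (simp only: sqrt_sq C)
    qed
    have "?c o\<^sub>L s o\<^sub>L ?c = (?c o\<^sub>L C o\<^sub>L ?c) + (?c o\<^sub>L D o\<^sub>L ?c)"
      by (simp only: sum compose_simps)
    then have "\<rho> (r o\<^sub>L C o\<^sub>L r) = \<rho> (?c o\<^sub>L C o\<^sub>L ?c) + \<rho> (?c o\<^sub>L D o\<^sub>L ?c)"
      by (simp only: cyc C rho_add sandwich D)
    then show ?thesis by (simp add: CC tr_sq_pos_part C)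
  qed
  have "s o\<^sub>L s = r o\<^sub>L s o\<^sub>L r"
    unfolding r(2)[symmetric] by (simp only: blinfun_compose_assoc)
  also have "\<dots> = (r o\<^sub>L A o\<^sub>L r) + (r o\<^sub>L B o\<^sub>L r)"
    by (simp only: s_def compose_simps)
  finally have "tr_sq s = \<rho> ((r o\<^sub>L A o\<^sub>L r) + (r o\<^sub>L B o\<^sub>L r))"
    by (simp add: tr_sq_pos_part s)
  also have "\<dots> = \<rho> (r o\<^sub>L A o\<^sub>L r) + \<rho> (r o\<^sub>L B o\<^sub>L r)"
    by (intro rho_add; simp only: conj A B)
      (rule pos_part_adj_compose, simp add: M_intros pos_part_M sqrt_pos A B r(1))+
  also have "\<dots> \<ge> tr_sq A + tr_sq B"
    by (intro add_mono ge[OF A B] ge[OF B A]) (simp_all add: s_def add.commute)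
  finally show ?thesis by (simp add: s_def)
qed

lemma tr_sq_diff_le_add:
  assumes A: "A \<in> pos_part M" and B: "B \<in> pos_part M"
  shows "tr_sq (A - B) \<le> tr_sq (A + B)"
proof (cases "tr_sq (A + B) < \<infinity>")
  case True
  have "tr_sq (A + B) + tr_sq (A - B) = 2 * (tr_sq A + tr_sq B)"
    by (simp add: tr_sq_parallelogram pos_part_M A B distrib_left)
  also have "\<dots> \<le> 2 * tr_sq (A + B)" by (intro mult_left_mono tr_sq_add_ge A B) simp
  also have "\<dots> = tr_sq (A + B) + tr_sq (A + B)" by (simp add: mult_2)
  finally show ?thesis using True by (auto simp: ennreal_add_left_cancel_le)
qed (simp add: not_less top_unique)

end

section \<open>Normality and approximate units\<close>

primrec op_power :: "'h::chilbert_space op \<Rightarrow> nat \<Rightarrow> 'h op" where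
  "op_power T 0 = id_blinfun"
| "op_power T (Suc m) = T o\<^sub>L op_power T m"

lemma op_power_commute: "op_power T m o\<^sub>L T = T o\<^sub>L op_power T m"
  by (induction m) (simp_all add: blinfun_compose_assoc)

lemma op_power_bounded_ops: "T \<in> bounded_ops \<Longrightarrow> op_power T m \<in> bounded_ops"
  by (induction m) (simp_all add: bounded_ops_intros)

lemma op_adj_op_power:
  assumes "T \<in> bounded_ops" "op_adj T = T"
  shows "op_adj (op_power T m) = op_power T m"
  by (induction m)
    (simp_all add: op_adj_algebra op_power_bounded_ops assms op_power_commute)

lemma norm_op_power_le:
  assumes "norm T \<le> 1"
  shows "norm (op_power T m) \<le> 1"
proof (induction m)
  case (Suc m)
  show ?case using norm_blinfun_compose_mono[OF assms Suc] by simp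
qed (simp add: norm_blinfun_id_le)

text \<open>Put \<open>v\<^sub>m = T\<^sup>m x\<close> with \<open>T = 1 - S\<close>. Since \<open>S\<^sup>2 \<le> S\<close>, the form of \<open>S\<close> at \<open>v\<^sub>m\<close> is at most
  \<open>\<parallel>v\<^sub>m\<parallel>\<^sup>2 - \<parallel>v\<^sub>m\<^sub>+\<^sub>1\<parallel>\<^sup>2\<close>, the increment of a convergent sequence.\<close>

lemma op_power_form_decay:
  fixes S :: "'h::chilbert_space op"
  assumes pos: "op_pos S" and norm_S: "norm S \<le> 1"
  defines "v x m \<equiv> op_power (id_blinfun - S) m x"
  shows "decseq (\<lambda>m. Re (cinner (S (v x m)) (v x m)))"
    and "(\<lambda>m. Re (cinner (S (v x m)) (v x m))) \<longlonglongrightarrow> 0"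
proof -
  define q where "q y = Re (cinner (S y) y)" for y
  have v_Suc: "v x (Suc m) = v x m - S (v x m)" for m
    by (simp add: v_def blinfun.bilinear_simps)
  have S2: "(norm (S y))\<^sup>2 \<le> q y" for y
    using norm_op_pos_square_le[OF assms(1,2)] by (simp add: q_def)
  have sym: "cinner (S (S y)) y = cinner (S y) (S y)" for y
    using cinner_op_adj[OF op_pos_bounded_ops[OF pos]] op_adj_op_pos[OF pos] by simp
  have "q (v x (Suc m)) \<le> q (v x m)" for m
  proof -
    let ?y = "v x m"
    have "q (S ?y) \<le> norm (S (S ?y)) * norm (S ?y)" unfolding q_def by (rule Re_cinner_le)
    also have "\<dots> \<le> norm (S ?y) * norm (S ?y)"
      using order_trans[OF norm_blinfun mult_right_mono[OF norm_S norm_ge_zero]]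
      by (intro mult_right_mono) auto
    finally have "q (S ?y) \<le> (norm (S ?y))\<^sup>2" by (simp add: power2_eq_square)
    moreover have "q (v x (Suc m)) = q ?y - 2 * (norm (S ?y))\<^sup>2 + q (S ?y)"
      by (simp add: q_def v_Suc blinfun.bilinear_simps cinner_simps sym Re_cinner_self)
    ultimately show ?thesis using zero_le_power2[of "norm (S ?y)"] by linarith
  qed
  then show "decseq (\<lambda>m. Re (cinner (S (v x m)) (v x m)))"
    by (simp add: decseq_Suc_iff q_def)
  define u where "u m = (norm (v x m))\<^sup>2" for m
  have q_le: "q (v x m) \<le> u m - u (Suc m)" for m
    using S2[of "v x m"] Re_cinner_commute[of "v x m" "S (v x m)"]
    by (simp add: u_def v_Suc norm_diff_square q_def)
  have q_ge: "0 \<le> q y" for y unfolding q_def by (rule op_pos_Re[OF pos])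
  have "u (Suc m) \<le> u m" for m using q_le[of m] q_ge[of "v x m"] by linarith
  then have "decseq u" by (simp add: decseq_Suc_iff)
  then obtain L where L: "u \<longlonglongrightarrow> L"
    using decseq_convergent[of u 0] by (auto simp: u_def)
  have "(\<lambda>m. u m - u (Suc m)) \<longlonglongrightarrow> L - L"
    by (intro tendsto_diff L LIMSEQ_Suc)
  then have lim: "(\<lambda>m. u m - u (Suc m)) \<longlonglongrightarrow> 0" by simp
  have "(\<lambda>m. q (v x m)) \<longlonglongrightarrow> 0"
    by (rule tendsto_sandwich[OF _ _ tendsto_const lim]) (intro always_eventually allI q_ge q_le)+
  then show "(\<lambda>m. Re (cinner (S (v x m)) (v x m))) \<longlonglongrightarrow> 0" by (simp add: q_def)
qed

locale normal_von_neumann_trace = von_neumann_trace M \<rho>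
  for M :: "'h::chilbert_space op set" and \<rho> :: "'h op \<Rightarrow> ennreal" +
  assumes normal: "normal_trace M \<rho>"
begin

lemma op_power_M: "T \<in> M \<Longrightarrow> op_power T m \<in> M"
  by (induction m) (simp_all add: M_intros)

text \<open>The operators \<open>S - T\<^sup>m S T\<^sup>m\<close> increase to \<open>S\<close> because the forms of \<open>T\<^sup>m S T\<^sup>m\<close> decrease to \<open>0\<close>,
  and normality turns this into convergence of the traces.\<close>

lemma rho_op_power_small:
  assumes S: "S \<in> pos_part M" and norm_S: "norm S \<le> 1" and fin: "\<rho> S < \<infinity>" and e: "0 < e"
  defines "T \<equiv> id_blinfun - S"
  shows "\<exists>m. \<rho> (op_power T m o\<^sub>L S o\<^sub>L op_power T m) < ennreal e"
proof (rule ccontr)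
  assume none: "\<not> ?thesis"
  define C where "C m = op_power T m o\<^sub>L S o\<^sub>L op_power T m" for m
  have large: "ennreal e \<le> \<rho> (C m)" for m
    using none by (simp add: C_def not_less)
  note pos = pos_part_op_pos[OF S]
  have T_M: "T \<in> M" by (simp add: T_def M_intros pos_part_M S)
  have T_adj: "op_adj T = T"
    by (simp add: T_def op_adj_algebra M_bounded pos_part_M S pos_part_adj)
  note T_power = op_power_M[OF T_M] M_bounded[OF op_power_M[OF T_M]]
    op_adj_op_power[OF M_bounded[OF T_M] T_adj]
  have C_pos: "C m \<in> pos_part M" for m
    using op_pos_conjugate[OF pos T_power(2)[of m]]
    by (simp add: C_def pos_part_def M_intros T_power pos_part_M[OF S])
  have C_form: "cinner (C m x) x = cinner (S (op_power T m x)) (op_power T m x)" for m x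
    using cinner_op_adj[OF T_power(2)[of m]] by (simp add: C_def T_power)
  note decay = op_power_form_decay[OF pos norm_S, folded T_def]
  have C_dec: "op_pos (C m - C n)" if "m \<le> n" for m n
  proof (rule op_posI)
    show "0 \<le> Re (cinner ((C m - C n) x) x)" for x
      using decseqD[OF decay(1)[of x] that]
      by (simp add: blinfun.bilinear_simps cinner_simps C_form)
  qed (simp_all add: bounded_ops_intros op_adj_algebra M_bounded pos_part_M C_pos pos_part_adj)
  have C0: "C 0 = S" by (simp add: C_def)
  have diff_pos: "S - C m \<in> pos_part M" for m
    using C_dec[of 0 m] by (simp add: C0 pos_part_def M_intros pos_part_M[OF S] pos_part_M[OF C_pos])
  define D where "D = range (\<lambda>m. S - C m)"
  have least: "op_le S B" if B: "B \<in> pos_part M" and ub: "\<forall>X\<in>D. op_le X B" for B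
    unfolding op_le_def
  proof (rule op_posI)
    fix x
    have "- Re (cinner (C m x) x) \<le> Re (cinner ((B - S) x) x)" for m
    proof -
      have "op_pos (B - (S - C m))" using ub by (auto simp: D_def op_le_def)
      from op_pos_Re[OF this, of x] show ?thesis
        by (simp add: blinfun.bilinear_simps cinner_simps)
    qed
    moreover have "(\<lambda>m. - Re (cinner (C m x) x)) \<longlonglongrightarrow> - 0"
      unfolding C_form by (intro tendsto_minus decay(2))
    ultimately show "0 \<le> Re (cinner ((B - S) x) x)"
      using LIMSEQ_le_const2[of "\<lambda>m. - Re (cinner (C m x) x)" 0] by auto
  qed (simp_all add: bounded_ops_intros op_adj_algebra M_bounded pos_part_M B S pos_part_adj)
  have "\<rho> S = (SUP X\<in>D. \<rho> X)"
  proof (rule normal[unfolded normal_trace_def, rule_format])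
    show "D \<noteq> {}" "D \<subseteq> pos_part M" "S \<in> pos_part M" using diff_pos S by (auto simp: D_def)
    show "op_le X S" if "X \<in> D" for X
      using that C_pos by (auto simp: D_def op_le_def pos_part_def)
    show "op_le S B" if "B \<in> pos_part M" "\<And>X. X \<in> D \<Longrightarrow> op_le X B" for B
      using that by (intro least) auto
    fix X Y assume "X \<in> D" "Y \<in> D"
    then obtain i j where "X = S - C i" "Y = S - C j" by (auto simp: D_def)
    then show "\<exists>Z\<in>D. op_le X Z \<and> op_le Y Z"
      using C_dec[of i "max i j"] C_dec[of j "max i j"]
      by (auto simp: D_def op_le_def)
  qed
  also have "\<dots> \<le> \<rho> S - ennreal e"
  proof (rule SUP_least)
    fix X assume "X \<in> D"
    then obtain m where X: "X = S - C m" by (auto simp: D_def)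
    have "\<rho> X + ennreal e \<le> \<rho> X + \<rho> (C m)" by (intro add_left_mono large)
    also have "\<dots> = \<rho> S" using rho_add[OF diff_pos C_pos, of m m] by (simp add: X)
    finally show "\<rho> X \<le> \<rho> S - ennreal e" by (simp add: ennreal_le_minus_iff add.commute)
  qed
  also have "\<dots> < \<rho> S"
  proof -
    obtain r where r: "0 \<le> r" "\<rho> S = ennreal r" using fin by (cases "\<rho> S") auto
    with large[of 0] have "e \<le> r" by (simp add: C0 ennreal_le_iff)
    then show ?thesis using e r by (simp add: ennreal_minus ennreal_less_iff)
  qed
  finally show False by simp
qed

end

section \<open>The completion\<close>

locale noncommutative_L2 = normal_von_neumann_trace M \<rho>
  for M :: "'h::chilbert_space op set" and \<rho> :: "'h op \<Rightarrow> ennreal" +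
  fixes \<iota> :: "'h op \<Rightarrow> 'l::{complex_normed_vector, complete_space}"
  assumes completion: "L2_completion M \<rho> \<iota>"
begin

abbreviation SI :: "'h op set" where "SI \<equiv> square_integrable M \<rho>"

lemmas SI_intros = square_integrable_mult_left square_integrable_mult_right
  square_integrable_add square_integrable_diff square_integrable_scaleC
  square_integrable_scaleR square_integrable_adj

lemma iota_add: "X \<in> SI \<Longrightarrow> Y \<in> SI \<Longrightarrow> \<iota> (X + Y) = \<iota> X + \<iota> Y"
  using completion by (simp add: L2_completion_def)

lemma iota_scaleC: "X \<in> SI \<Longrightarrow> \<iota> (c *\<^sub>C X) = c *\<^sub>C \<iota> X"
  using completion by (simp add: L2_completion_def)

lemma iota_diff: "X \<in> SI \<Longrightarrow> Y \<in> SI \<Longrightarrow> \<iota> (X - Y) = \<iota> X - \<iota> Y"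
  using iota_add[of X "(- 1) *\<^sub>C Y"] iota_scaleC[of Y "- 1"] square_integrable_scaleC[of Y "- 1"]
  by (simp add: scaleC_minus_one)

lemma norm_iota: "X \<in> SI \<Longrightarrow> norm (\<iota> X) = sqrt (enn2real (tr_sq X))"
  using completion by (simp add: L2_completion_def norm2_eq square_integrable_M)

lemma norm_iota_le:
  assumes "X \<in> SI" "Y \<in> SI" "0 \<le> K" "tr_sq Y \<le> ennreal (K\<^sup>2) * tr_sq X"
  shows "norm (\<iota> Y) \<le> K * norm (\<iota> X)"
proof -
  have "enn2real (tr_sq Y) \<le> enn2real (ennreal (K\<^sup>2) * tr_sq X)"
    using assms by (intro enn2real_mono) (auto simp: square_integrable_iff ennreal_mult_less_top)
  then have "sqrt (enn2real (tr_sq Y)) \<le> sqrt (K\<^sup>2 * enn2real (tr_sq X))"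
    by (simp add: enn2real_mult)
  then show ?thesis using assms by (simp add: norm_iota real_sqrt_mult)
qed

lemma norm_iota_mult_left:
  assumes "B \<in> M" "X \<in> SI" "norm B \<le> K"
  shows "norm (\<iota> (B o\<^sub>L X)) \<le> K * norm (\<iota> X)"
  using order_trans[OF norm_ge_zero assms(3)] assms
  by (intro norm_iota_le tr_sq_mult_left) (simp_all add: SI_intros square_integrable_M)

lemma norm_iota_mult_right:
  assumes "B \<in> M" "X \<in> SI" "norm B \<le> K"
  shows "norm (\<iota> (X o\<^sub>L B)) \<le> K * norm (\<iota> X)"
  using order_trans[OF norm_ge_zero assms(3)] assms
  by (intro norm_iota_le tr_sq_mult_right) (simp_all add: SI_intros square_integrable_M)

lemma norm_iota_adj: "X \<in> SI \<Longrightarrow> norm (\<iota> (op_adj X)) = norm (\<iota> X)"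
  by (simp add: norm_iota SI_intros tr_sq_adj square_integrable_M)

lemma iota_dense: "closure (\<iota> ` SI) = UNIV"
  using completion by (simp add: L2_completion_def)

lemma iota_sequence:
  obtains X where "\<And>n. X n \<in> SI" "(\<lambda>n. \<iota> (X n)) \<longlonglongrightarrow> \<xi>"
proof -
  have "\<xi> \<in> closure (\<iota> ` SI)" by (simp add: iota_dense)
  then obtain f where f: "\<forall>n. f n \<in> \<iota> ` SI" and lim: "f \<longlonglongrightarrow> \<xi>"
    unfolding closure_sequential by blast
  from f have "\<forall>n. \<exists>X. X \<in> SI \<and> f n = \<iota> X" by blast
  then obtain X where X: "\<And>n. X n \<in> SI" "\<And>n. f n = \<iota> (X n)" by metis
  have "f = (\<lambda>n. \<iota> (X n))" by (rule ext) (rule X)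
  with lim show thesis by (intro that[of X] X) simp
qed

text \<open>With \<open>S\<close> a multiple of \<open>W\<^sup>* W + W W\<^sup>*\<close> and \<open>T = 1 - S\<close>, the element \<open>Y = 1 - T\<^sup>m\<close> is a
  polynomial in \<open>S\<close> without constant term, hence square integrable, while \<open>W T\<^sup>m\<close> and \<open>T\<^sup>m W\<close>
  have \<open>L\<^sup>2\<close> norms controlled by \<open>\<rho>(T\<^sup>m S T\<^sup>m)\<close>, since \<open>W\<^sup>* W\<close> and \<open>W W\<^sup>*\<close> are at most a
  multiple of \<open>S\<close>.\<close>

lemma approximate_unit:
  assumes W: "W \<in> SI" and e: "0 < e"
  obtains Y where "Y \<in> SI" "op_adj Y = Y" "norm Y \<le> 2"
    "norm (\<iota> (W - (W o\<^sub>L Y))) < e" "norm (\<iota> (W - (Y o\<^sub>L W))) < e"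
proof -
  note W_M = square_integrable_M[OF W]
  let ?l = "op_adj W o\<^sub>L W" and ?r = "op_adj (op_adj W) o\<^sub>L op_adj W"
  define R where "R = ?l + ?r"
  define k where "k = 1 + norm R"
  have k: "k > 0" by (simp add: k_def add_pos_nonneg)
  define S where "S = (1/k) *\<^sub>R R"
  define T where "T = id_blinfun - S"
  have lr: "?l \<in> pos_part M" "?r \<in> pos_part M" by (simp_all add: pos_part_adj_compose M_intros W_M)
  have R: "R \<in> pos_part M" unfolding R_def by (rule pos_part_add[OF lr])
  have S: "S \<in> pos_part M" unfolding S_def using k by (intro pos_part_scaleR R) simp
  have norm_S: "norm S \<le> 1" using k by (simp add: S_def k_def)
  have "\<rho> R = tr_sq W + tr_sq (op_adj W)" unfolding R_def by (simp only: rho_add[OF lr] tr_sq_def)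
  then have "\<rho> R < \<infinity>" using W by (simp add: tr_sq_adj W_M square_integrable_iff)
  then have fin: "\<rho> S < \<infinity>" using k by (simp add: S_def rho_scaleR R ennreal_mult_less_top)
  have "0 < e\<^sup>2 / k" using e k by simp
  from rho_op_power_small[OF S norm_S fin this, folded T_def] obtain m
    where m: "\<rho> (op_power T m o\<^sub>L S o\<^sub>L op_power T m) < ennreal (e\<^sup>2 / k)" ..
  define U where "U = op_power T m"
  have T_M: "T \<in> M" by (simp add: T_def M_intros pos_part_M S)
  have T_adj: "op_adj T = T"
    by (simp add: T_def op_adj_algebra M_bounded pos_part_M S pos_part_adj)
  have U_M: "U \<in> M" unfolding U_def by (rule op_power_M[OF T_M])
  have U_adj: "op_adj U = U" unfolding U_def by (rule op_adj_op_power[OF M_bounded[OF T_M] T_adj])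
  have norm_U: "norm U \<le> 1" unfolding U_def T_def
    by (intro norm_op_power_le norm_id_diff_op_pos_le norm_S pos_part_op_pos S)
  have sandwich: "U o\<^sub>L (op_adj X o\<^sub>L X) o\<^sub>L U = op_adj (X o\<^sub>L U) o\<^sub>L (X o\<^sub>L U)" if "X \<in> M" for X
    by (simp only: op_adj_algebra(3)[OF M_bounded[OF that] M_bounded[OF U_M]] U_adj
        blinfun_compose_assoc)
  have USU: "U o\<^sub>L S o\<^sub>L U \<in> pos_part M"
    using op_pos_conjugate[OF pos_part_op_pos[OF S] M_bounded[OF U_M]]
    by (simp add: pos_part_def U_adj M_intros U_M pos_part_M[OF S])
  have "tr_sq (W o\<^sub>L U) + tr_sq (op_adj W o\<^sub>L U) = \<rho> ((U o\<^sub>L ?l o\<^sub>L U) + (U o\<^sub>L ?r o\<^sub>L U))"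
    unfolding tr_sq_def sandwich[OF W_M] sandwich[OF M_adj[OF W_M]]
    by (rule rho_add[symmetric]) (simp_all add: pos_part_adj_compose M_intros W_M U_M)
  also have "(U o\<^sub>L ?l o\<^sub>L U) + (U o\<^sub>L ?r o\<^sub>L U) = k *\<^sub>R (U o\<^sub>L S o\<^sub>L U)"
    using k by (simp add: S_def R_def compose_simps)
  also have "\<rho> \<dots> = ennreal k * \<rho> (U o\<^sub>L S o\<^sub>L U)" using k by (intro rho_scaleR USU) simp
  also have "\<dots> < ennreal k * ennreal (e\<^sup>2 / k)"
    using m k unfolding U_def by (intro ennreal_mult_strict_left_mono) auto
  also have "\<dots> = ennreal (e\<^sup>2)" using k by (simp add: ennreal_mult[symmetric])
  finally have sum: "tr_sq (W o\<^sub>L U) + tr_sq (op_adj W o\<^sub>L U) < ennreal (e\<^sup>2)" .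
  have small: "norm (\<iota> X) < e" if "X \<in> SI" "tr_sq X < ennreal (e\<^sup>2)" for X
  proof -
    have "enn2real (tr_sq X) < e\<^sup>2"
      using that(2) by (cases "tr_sq X") (simp_all add: ennreal_less_iff)
    then show ?thesis using e that(1) real_sqrt_less_mono[of "enn2real (tr_sq X)" "e\<^sup>2"]
      by (simp add: norm_iota)
  qed
  have WU: "norm (\<iota> (W o\<^sub>L U)) < e"
    using sum by (intro small SI_intros W U_M order.strict_trans1[OF _ sum]) simp
  have "tr_sq (U o\<^sub>L W) = tr_sq (op_adj W o\<^sub>L U)"
    using tr_sq_adj[of "U o\<^sub>L W"] by (simp add: op_adj_algebra M_bounded M_intros W_M U_M U_adj)
  then have UW: "norm (\<iota> (U o\<^sub>L W)) < e"
    using sum by (intro small SI_intros W U_M order.strict_trans1[OF _ sum]) simp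
  have S_SI: "S \<in> SI" unfolding S_def R_def by (intro SI_intros W M_adj W_M)
  have Y_SI: "id_blinfun - op_power T n \<in> SI" for n
  proof (induction n)
    case 0
    show ?case using square_integrable_diff[OF W W] by simp
  next
    case (Suc n)
    have eq: "id_blinfun - op_power T (Suc n) = (id_blinfun - op_power T n) + (S o\<^sub>L op_power T n)"
      by (simp add: T_def compose_simps)
    show ?case unfolding eq by (intro SI_intros Suc S_SI op_power_M T_M)
  qed
  show thesis
  proof (rule that[of "id_blinfun - U"])
    show "id_blinfun - U \<in> SI" unfolding U_def by (rule Y_SI)
    show "op_adj (id_blinfun - U) = id_blinfun - U"
      by (simp add: op_adj_algebra M_bounded U_M U_adj)
    show "norm (id_blinfun - U) \<le> 2"
      using norm_triangle_ineq4[of id_blinfun U] norm_blinfun_id_le[where ?'a = 'h] norm_U by simp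
    show "norm (\<iota> (W - (W o\<^sub>L (id_blinfun - U)))) < e" using WU by (simp add: compose_simps)
    show "norm (\<iota> (W - ((id_blinfun - U) o\<^sub>L W))) < e" using UW by (simp add: compose_simps)
  qed
qed

end

section \<open>Positive elements as limits of positive operators\<close>

lemma (in von_neumann_trace) norm_projection_le:
  assumes "P \<in> projections M"
  shows "norm P \<le> 1"
proof (rule norm_blinfun_bound)
  fix x
  have P: "P \<in> bounded_ops" "op_adj P = P" "P o\<^sub>L P = P"
    using assms by (auto simp: projections_def M_bounded)
  have "P (P x) = P x" using arg_cong[OF P(3), of "\<lambda>B. blinfun_apply B x"] by simp
  then have "cinner (P x) (P x) = cinner (P x) x"
    using cinner_op_adj[OF P(1), of "P x" x] by (simp add: P(2))
  then have "norm (P x) * norm (P x) = Re (cinner (P x) x)"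
    by (metis Re_cinner_self power2_eq_square)
  also have "\<dots> \<le> norm (P x) * norm x" by (rule Re_cinner_le)
  finally show "norm (P x) \<le> 1 * norm x"
    by (cases "norm (P x) = 0") (simp_all add: mult_le_cancel_left)
qed simp

text \<open>Where \<open>T\<close> is everywhere defined and bounded after \<open>P\<close>, the compression \<open>P T P\<close> is a
  bounded operator; it lies in the algebra because \<open>T\<close> and \<open>P\<close> commute with its commutant, and
  it inherits positivity from \<open>T\<close>.\<close>

lemma (in von_neumann_trace) positive_compression:
  assumes aff: "affiliated M T" and pos: "graph_pos T" and P: "P \<in> projections M"
    and X: "X \<in> M" and d: "0 \<le> d"
    and near: "\<And>x. \<exists>y. (P x, y) \<in> T \<and> norm (X (P x) - y) \<le> d * norm x"
  shows "\<exists>A\<in>pos_part M. norm ((P o\<^sub>L X o\<^sub>L P) - A) \<le> d"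
proof -
  obtain g where gT: "\<And>x. (P x, g x) \<in> T" and g: "\<And>x. norm (X (P x) - g x) \<le> d * norm x"
    using near by metis
  have sub: "complex_subspace T" and sv: "single_valued T"
    using aff by (auto simp: affiliated_def closed_densely_defined_def)
  have P_M: "P \<in> M" and P_adj: "op_adj P = P" using P by (auto simp: projections_def)
  have P_lin: "P (c *\<^sub>C x) = c *\<^sub>C P x" for c x by (rule bounded_opsD[OF M_bounded[OF P_M]])
  have uniq: "g x = y" if "(P x, y) \<in> T" for x y
    using single_valuedD[OF sv gT that] .
  have g_add: "g (x + y) = g x + g y" for x y
  proof (rule uniq)
    have "(P x, g x) + (P y, g y) \<in> T"
      using sub gT unfolding complex_subspace_def by blast
    then show "(P (x + y), g x + g y) \<in> T" by (simp add: blinfun.bilinear_simps)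
  qed
  have g_scaleC: "g (c *\<^sub>C x) = c *\<^sub>C g x" for c x
  proof (rule uniq)
    have "c *\<^sub>C (P x, g x) \<in> T"
      using sub gT unfolding complex_subspace_def by blast
    then show "(P (c *\<^sub>C x), c *\<^sub>C g x) \<in> T" by (simp add: P_lin scaleC_prod_def)
  qed
  have "bounded_linear g"
  proof (rule bounded_linear_intro[where K = "norm (X o\<^sub>L P) + d"])
    show "norm (g x) \<le> norm x * (norm (X o\<^sub>L P) + d)" for x
      using norm_triangle_ineq2[of "g x" "X (P x)"] g[of x] norm_blinfun[of "X o\<^sub>L P" x]
      by (simp add: algebra_simps norm_minus_commute)
  qed (simp_all add: g_add g_scaleC scaleR_scaleC)
  then have G: "blinfun_apply (Blinfun g) = g" by (rule bounded_linear_Blinfun_apply)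
  have G_M: "Blinfun g \<in> M"
  proof (rule M_bicommutantI)
    show "Blinfun g \<in> bounded_ops" by (simp add: bounded_ops_def G g_scaleC)
    fix B assume B: "B \<in> commutant M"
    then have "B o\<^sub>L P = P o\<^sub>L B" using P_M by (simp add: commutant_def)
    then have BP: "B (P x) = P (B x)" for x
      by (metis blinfun_apply_blinfun_compose)
    have "(B (P x), B (g x)) \<in> T" for x
      using aff B gT[of x] unfolding affiliated_def by blast
    then have "g (B x) = B (g x)" for x by (intro uniq) (simp add: BP)
    then show "Blinfun g o\<^sub>L B = B o\<^sub>L Blinfun g" by (intro blinfun_eqI) (simp add: G)
  qed
  define A where "A = P o\<^sub>L Blinfun g"
  have "op_pos A" unfolding op_pos_def
  proof (intro conjI allI)
    show "A \<in> bounded_ops" unfolding A_def by (intro M_bounded M_intros P_M G_M)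
    fix x
    have "cinner (A x) x = cinner (g x) (P x)"
      using cinner_op_adj[OF M_bounded[OF P_M], of "g x" x] by (simp add: A_def G P_adj)
    moreover have "cinner (g x) (P x) \<in> \<real>\<^sub>\<ge>\<^sub>0"
      using pos gT[of x] unfolding graph_pos_def by auto
    ultimately show "cinner (A x) x \<in> \<real>\<^sub>\<ge>\<^sub>0" by simp
  qed
  then have "A \<in> pos_part M" by (simp add: pos_part_def A_def M_intros P_M G_M)
  moreover have "norm ((P o\<^sub>L X o\<^sub>L P) - A) \<le> d"
  proof (rule norm_blinfun_bound[OF d])
    fix x
    have "norm (P (X (P x) - g x)) \<le> 1 * norm (X (P x) - g x)"
      by (intro order_trans[OF norm_blinfun] mult_right_mono norm_projection_le P) simp
    with g[of x] show "norm (((P o\<^sub>L X o\<^sub>L P) - A) x) \<le> d * norm x"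
      by (simp add: A_def G blinfun.bilinear_simps)
  qed
  ultimately show ?thesis by blast
qed

context noncommutative_L2
begin

lemma norm_iota_sandwich_le:
  assumes "B \<in> M" "C \<in> M" "X \<in> SI" "norm B \<le> b" "norm C \<le> c"
  shows "norm (\<iota> (B o\<^sub>L X o\<^sub>L C)) \<le> b * c * norm (\<iota> X)"
proof -
  have "norm (\<iota> (B o\<^sub>L X o\<^sub>L C)) \<le> c * norm (\<iota> (B o\<^sub>L X))"
    by (intro norm_iota_mult_right SI_intros assms)
  also have "\<dots> \<le> c * (b * norm (\<iota> X))"
    using order_trans[OF norm_ge_zero assms(5)]
    by (intro mult_left_mono norm_iota_mult_left assms)
  finally show ?thesis by (simp add: ac_simps)
qed

text \<open>With \<open>Q = 1 - P\<close>, the error is \<open>Q W + P W Q\<close>, and each term is at most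
  \<open>\<parallel>W\<parallel> \<parallel>Q\<parallel>\<^sub>2 = \<parallel>W\<parallel> \<rho>(Q)\<^sup>1\<^sup>/\<^sup>2\<close>: the bounded factor may stand on either side of \<open>Q\<close>.\<close>

lemma norm_iota_compression_le:
  assumes W: "W \<in> SI" and P: "P \<in> projections M" and d: "0 \<le> d"
    and trace_le: "\<rho> (id_blinfun - P) \<le> ennreal d"
  shows "norm (\<iota> ((P o\<^sub>L W o\<^sub>L P) - W)) \<le> 2 * norm W * sqrt d"
proof -
  define Q where "Q = id_blinfun - P"
  note W_M = square_integrable_M[OF W]
  have P_M: "P \<in> M" and P_adj: "op_adj P = P" and PP: "P o\<^sub>L P = P"
    using P by (auto simp: projections_def)
  have Q_M: "Q \<in> M" by (simp add: Q_def M_intros P_M)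
  have "op_adj Q o\<^sub>L Q = Q"
    by (simp add: Q_def op_adj_algebra M_bounded P_M P_adj compose_simps PP)
  then have "tr_sq Q = \<rho> Q" by (simp add: tr_sq_def)
  with trace_le have le: "tr_sq Q \<le> ennreal d" by (simp add: Q_def)
  then have Q: "Q \<in> SI" by (auto simp: square_integrable_iff Q_M intro: le_less_trans)
  have "enn2real (tr_sq Q) \<le> d" using enn2real_mono[OF le] d by simp
  then have norm_Q: "norm (\<iota> Q) \<le> sqrt d" by (simp add: norm_iota Q)
  have "norm (P o\<^sub>L W) \<le> 1 * norm W"
    by (intro norm_blinfun_compose_mono norm_projection_le P) simp
  then have PWQ: "norm (\<iota> ((P o\<^sub>L W) o\<^sub>L Q)) \<le> norm W * norm (\<iota> Q)"
    by (intro norm_iota_mult_left Q) (simp_all add: M_intros P_M W_M)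
  have QW: "norm (\<iota> (Q o\<^sub>L W)) \<le> norm W * norm (\<iota> Q)"
    by (intro norm_iota_mult_right Q W_M) simp
  have mem: "Q o\<^sub>L W \<in> SI" "(P o\<^sub>L W) o\<^sub>L Q \<in> SI" "P o\<^sub>L W o\<^sub>L P \<in> SI"
    by (simp_all add: SI_intros W P_M Q_M)
  have "W - (P o\<^sub>L W o\<^sub>L P) = (Q o\<^sub>L W) + ((P o\<^sub>L W) o\<^sub>L Q)"
    by (simp add: Q_def compose_simps)
  then have "\<iota> W - \<iota> (P o\<^sub>L W o\<^sub>L P) = \<iota> (Q o\<^sub>L W) + \<iota> ((P o\<^sub>L W) o\<^sub>L Q)"
    by (metis iota_diff iota_add mem W)
  then have "norm (\<iota> ((P o\<^sub>L W o\<^sub>L P) - W)) = norm (\<iota> (Q o\<^sub>L W) + \<iota> ((P o\<^sub>L W) o\<^sub>L Q))"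
    by (simp add: iota_diff mem W norm_minus_commute)
  also have "\<dots> \<le> norm W * norm (\<iota> Q) + norm W * norm (\<iota> Q)"
    by (intro norm_triangle_mono QW PWQ)
  also have "\<dots> \<le> norm W * sqrt d + norm W * sqrt d"
    by (intro add_mono mult_left_mono norm_Q) simp_all
  finally show ?thesis by (simp add: ac_simps)
qed

text \<open>\<open>Z\<close> is a compression \<open>P X\<^sub>n P\<close> and \<open>A\<close> is \<open>P T P\<close>. The \<open>L\<^sup>2\<close> distance of \<open>P X\<^sub>n P\<close> from \<open>\<xi>\<close> is
  controlled by replacing \<open>X\<^sub>n\<close> with a fixed bounded \<open>W = X\<^sub>N\<close>, as the allowed trace of \<open>1 - P\<close> depends
  on \<open>\<parallel>W\<parallel>\<close>. At this stage \<open>Z\<close> is close to a positive operator only in operator norm, which says nothing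
  about the distance in \<open>L\<^sup>2\<close> when the trace is infinite.\<close>

lemma L2_pos_nearly_positive:
  assumes pos: "L2_pos M \<rho> \<iota> \<xi>" and e: "0 < e" and d: "0 < d"
  obtains Z A where "Z \<in> SI" "norm (\<iota> Z - \<xi>) < e" "A \<in> pos_part M" "norm (Z - A) \<le> d"
proof -
  obtain T X where aff: "affiliated M T" and T_pos: "graph_pos T"
    and X: "\<And>n. X n \<in> SI" and lim: "(\<lambda>n. \<iota> (X n)) \<longlonglongrightarrow> \<xi>"
    and conv: "converges_in_measure M \<rho> X T"
    using pos unfolding L2_pos_def L2_operator_def by blast
  define t where "t = e / 4"
  have t: "t > 0" using e by (simp add: t_def)
  obtain N where N: "\<And>n. n \<ge> N \<Longrightarrow> norm (\<iota> (X n) - \<xi>) < t"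
    using LIMSEQ_D[OF lim t] by blast
  define W where "W = X N"
  define \<delta> where "\<delta> = (t / (2 * (1 + norm W)))\<^sup>2"
  have w: "1 + norm W > 0" by (simp add: add_pos_nonneg)
  have \<delta>: "\<delta> > 0" using t w by (simp add: \<delta>_def)
  obtain N' where N': "\<And>n. n \<ge> N' \<Longrightarrow> \<exists>P\<in>projections M. \<rho> (id_blinfun - P) \<le> ennreal \<delta> \<and>
      (\<forall>x. \<exists>y. (P x, y) \<in> T \<and> norm (X n (P x) - y) \<le> d * norm x)"
    using conv d \<delta> unfolding converges_in_measure_def by blast
  define n where "n = max N N'"
  obtain P where P: "P \<in> projections M" and P_trace: "\<rho> (id_blinfun - P) \<le> ennreal \<delta>"
    and near: "\<And>x. \<exists>y. (P x, y) \<in> T \<and> norm (X n (P x) - y) \<le> d * norm x"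
    using N'[of n] unfolding n_def by auto
  obtain A where A: "A \<in> pos_part M" "norm ((P o\<^sub>L X n o\<^sub>L P) - A) \<le> d"
    using positive_compression[OF aff T_pos P square_integrable_M[OF X] less_imp_le[OF d] near]
    by blast
  have P_M: "P \<in> M" using P by (simp add: projections_def)
  have Z: "P o\<^sub>L X n o\<^sub>L P \<in> SI" and PWP: "P o\<^sub>L W o\<^sub>L P \<in> SI" and W: "W \<in> SI"
    by (simp_all add: W_def SI_intros X P_M)
  have W_near: "norm (\<iota> W - \<xi>) < t" unfolding W_def by (rule N) simp
  have Xn_near: "norm (\<iota> (X n) - \<xi>) < t" by (rule N) (simp add: n_def)
  have "(P o\<^sub>L X n o\<^sub>L P) - (P o\<^sub>L W o\<^sub>L P) = P o\<^sub>L (X n - W) o\<^sub>L P"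
    by (simp add: compose_simps)
  then have "norm (\<iota> (P o\<^sub>L X n o\<^sub>L P) - \<iota> (P o\<^sub>L W o\<^sub>L P)) \<le> 1 * 1 * norm (\<iota> (X n - W))"
    using norm_iota_sandwich_le[OF P_M P_M _ norm_projection_le[OF P] norm_projection_le[OF P],
        of "X n - W"]
    by (simp add: iota_diff[symmetric] Z PWP SI_intros X W)
  also have "\<dots> \<le> norm (\<iota> (X n) - \<xi>) + norm (\<iota> W - \<xi>)"
    using norm_triangle_ineq4[of "\<iota> (X n) - \<xi>" "\<iota> W - \<xi>"] by (simp add: iota_diff X W)
  finally have 1: "norm (\<iota> (P o\<^sub>L X n o\<^sub>L P) - \<iota> (P o\<^sub>L W o\<^sub>L P)) < 2 * t"
    using W_near Xn_near by simp
  have "norm (\<iota> (P o\<^sub>L W o\<^sub>L P) - \<iota> W) \<le> 2 * norm W * sqrt \<delta>"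
    using norm_iota_compression_le[OF W P less_imp_le[OF \<delta>] P_trace] by (simp add: iota_diff PWP W)
  also have "sqrt \<delta> = t / (2 * (1 + norm W))"
    using t w by (simp only: \<delta>_def real_sqrt_abs) simp
  also have "2 * norm W * \<dots> \<le> t"
    using t w by (simp add: field_simps)
  finally have 2: "norm (\<iota> (P o\<^sub>L W o\<^sub>L P) - \<iota> W) \<le> t" .
  have "\<iota> (P o\<^sub>L X n o\<^sub>L P) - \<xi> = (\<iota> (P o\<^sub>L X n o\<^sub>L P) - \<iota> (P o\<^sub>L W o\<^sub>L P))
      + (\<iota> (P o\<^sub>L W o\<^sub>L P) - \<iota> W) + (\<iota> W - \<xi>)" by simp
  also have "norm \<dots> < e"
    using norm_triangle_ineq[of "(\<iota> (P o\<^sub>L X n o\<^sub>L P) - \<iota> (P o\<^sub>L W o\<^sub>L P)) + (\<iota> (P o\<^sub>L W o\<^sub>L P) - \<iota> W)"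
        "\<iota> W - \<xi>"]
      norm_triangle_ineq[of "\<iota> (P o\<^sub>L X n o\<^sub>L P) - \<iota> (P o\<^sub>L W o\<^sub>L P)" "\<iota> (P o\<^sub>L W o\<^sub>L P) - \<iota> W"]
      1 2 W_near unfolding t_def by linarith
  finally show thesis by (intro that[OF Z _ A])
qed

text \<open>Cutting down by an approximate unit \<open>Y\<close> of finite \<open>L\<^sup>2\<close> norm turns the operator norm estimate
  into an \<open>L\<^sup>2\<close> estimate: \<open>\<parallel>Y (Z - A) Y\<parallel>\<^sub>2 \<le> \<parallel>Y\<parallel> \<parallel>Z - A\<parallel> \<parallel>Y\<parallel>\<^sub>2\<close>. The unit is chosen first, for
  some \<open>W\<close> near \<open>\<xi>\<close>, and \<open>Z\<close> and \<open>A\<close> only afterwards, with precision depending on \<open>\<parallel>Y\<parallel>\<^sub>2\<close>.\<close>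

lemma L2_pos_closure:
  assumes pos: "L2_pos M \<rho> \<iota> \<xi>"
  shows "\<xi> \<in> closure (\<iota> ` (pos_part M \<inter> SI))"
  unfolding closure_approachable
proof (intro allI impI)
  fix e :: real assume e: "0 < e"
  define t where "t = e / 16"
  have t: "t > 0" using e by (simp add: t_def)
  obtain W where W: "W \<in> SI" and W_near: "norm (\<iota> W - \<xi>) < t"
    using L2_pos_nearly_positive[OF pos t zero_less_one] by metis
  obtain Y where Y: "Y \<in> SI" and Y_adj: "op_adj Y = Y" and norm_Y: "norm Y \<le> 2"
    and WY: "norm (\<iota> (W - (W o\<^sub>L Y))) < t" and YW: "norm (\<iota> (W - (Y o\<^sub>L W))) < t"
    using approximate_unit[OF W t] by metis
  define d where "d = t / (2 * (1 + norm (\<iota> Y)))"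
  have c: "1 + norm (\<iota> Y) > 0" by (simp add: add_pos_nonneg)
  have d: "d > 0" using t c by (simp add: d_def)
  obtain Z A where Z: "Z \<in> SI" and Z_near: "norm (\<iota> Z - \<xi>) < t"
    and A: "A \<in> pos_part M" and ZA: "norm (Z - A) \<le> d"
    using L2_pos_nearly_positive[OF pos t d] by metis
  note mem = square_integrable_M[OF Y] square_integrable_M[OF Z] square_integrable_M[OF W]
    pos_part_M[OF A]
  have SI: "Y o\<^sub>L A o\<^sub>L Y \<in> SI" "Y o\<^sub>L Z o\<^sub>L Y \<in> SI" "Y o\<^sub>L W o\<^sub>L Y \<in> SI" "Y o\<^sub>L W \<in> SI" "W o\<^sub>L Y \<in> SI"
    by (simp_all add: SI_intros mem Y Z W)
  have 1: "norm (\<iota> (Y o\<^sub>L A o\<^sub>L Y) - \<iota> (Y o\<^sub>L Z o\<^sub>L Y)) \<le> t"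
  proof -
    have "norm (\<iota> (Y o\<^sub>L A o\<^sub>L Y) - \<iota> (Y o\<^sub>L Z o\<^sub>L Y)) = norm (\<iota> ((Y o\<^sub>L (Z - A)) o\<^sub>L Y))"
      using norm_minus_commute by (simp add: iota_diff SI compose_simps)
    also have "\<dots> \<le> (2 * d) * norm (\<iota> Y)"
      by (intro norm_iota_mult_left norm_blinfun_compose_mono norm_Y ZA Y)
        (simp add: M_intros mem)
    also have "\<dots> \<le> t" using t c by (simp add: d_def field_simps)
    finally show ?thesis .
  qed
  have 2: "norm (\<iota> (Y o\<^sub>L Z o\<^sub>L Y) - \<iota> (Y o\<^sub>L W o\<^sub>L Y)) \<le> 8 * t"
  proof -
    have "norm (\<iota> (Y o\<^sub>L Z o\<^sub>L Y) - \<iota> (Y o\<^sub>L W o\<^sub>L Y)) = norm (\<iota> (Y o\<^sub>L (Z - W) o\<^sub>L Y))"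
      by (simp add: iota_diff[symmetric] SI compose_simps)
    also have "\<dots> \<le> 2 * 2 * norm (\<iota> (Z - W))"
      by (intro norm_iota_sandwich_le mem norm_Y SI_intros Z W)
    also have "norm (\<iota> (Z - W)) \<le> norm (\<iota> Z - \<xi>) + norm (\<iota> W - \<xi>)"
      using norm_triangle_ineq4[of "\<iota> Z - \<xi>" "\<iota> W - \<xi>"] by (simp add: iota_diff Z W)
    finally show ?thesis using Z_near W_near by simp
  qed
  have 3: "norm (\<iota> (Y o\<^sub>L W o\<^sub>L Y) - \<iota> W) \<le> 3 * t"
  proof -
    have "W - (Y o\<^sub>L W o\<^sub>L Y) = (W - (Y o\<^sub>L W)) + (Y o\<^sub>L (W - (W o\<^sub>L Y)))"
      by (simp add: compose_simps blinfun_compose_assoc)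
    moreover have "\<iota> \<dots> = \<iota> (W - (Y o\<^sub>L W)) + \<iota> (Y o\<^sub>L (W - (W o\<^sub>L Y)))"
      by (intro iota_add SI_intros SI W mem)
    ultimately have "\<iota> W - \<iota> (Y o\<^sub>L W o\<^sub>L Y)
        = \<iota> (W - (Y o\<^sub>L W)) + \<iota> (Y o\<^sub>L (W - (W o\<^sub>L Y)))"
      by (simp only: iota_diff[OF W SI(3), symmetric])
    then have "norm (\<iota> W - \<iota> (Y o\<^sub>L W o\<^sub>L Y))
        \<le> norm (\<iota> (W - (Y o\<^sub>L W))) + norm (\<iota> (Y o\<^sub>L (W - (W o\<^sub>L Y))))"
      by (simp only: norm_triangle_ineq)
    also have "\<dots> \<le> norm (\<iota> (W - (Y o\<^sub>L W))) + 2 * norm (\<iota> (W - (W o\<^sub>L Y)))"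
      by (intro add_left_mono norm_iota_mult_left mem norm_Y SI_intros SI W)
    finally show ?thesis using WY YW by (simp add: norm_minus_commute)
  qed
  have "\<iota> (Y o\<^sub>L A o\<^sub>L Y) - \<xi> = (\<iota> (Y o\<^sub>L A o\<^sub>L Y) - \<iota> (Y o\<^sub>L Z o\<^sub>L Y))
      + (\<iota> (Y o\<^sub>L Z o\<^sub>L Y) - \<iota> (Y o\<^sub>L W o\<^sub>L Y)) + (\<iota> (Y o\<^sub>L W o\<^sub>L Y) - \<iota> W) + (\<iota> W - \<xi>)" by simp
  also have "norm \<dots> \<le> t + 8 * t + 3 * t + t"
    by (intro norm_triangle_mono 1 2 3 less_imp_le[OF W_near])
  also have "\<dots> < e" using e by (simp add: t_def)
  finally have "dist (\<iota> (Y o\<^sub>L A o\<^sub>L Y)) \<xi> < e" by (simp add: dist_norm)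
  moreover have "Y o\<^sub>L A o\<^sub>L Y \<in> pos_part M"
    using op_pos_conjugate[OF pos_part_op_pos[OF A] M_bounded[OF mem(1)]]
    by (simp add: pos_part_def M_intros mem Y_adj)
  ultimately show "\<exists>y\<in>\<iota> ` (pos_part M \<inter> SI). dist y \<xi> < e" using SI(1) by blast
qed

text \<open>In the Hilbert space \<open>L\<^sup>2\<close> this says that the inner product of \<open>\<xi>\<close> and \<open>\<eta>\<close> has nonnegative
  real part.\<close>

lemma norm_diff_le_norm_add:
  assumes "\<xi> \<in> closure (\<iota> ` (pos_part M \<inter> SI))" "\<eta> \<in> closure (\<iota> ` (pos_part M \<inter> SI))"
  shows "norm (\<xi> - \<eta>) \<le> norm (\<xi> + \<eta>)"
proof -
  obtain f g where f: "\<forall>n. f n \<in> \<iota> ` (pos_part M \<inter> SI)" "f \<longlonglongrightarrow> \<xi>"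
    and g: "\<forall>n. g n \<in> \<iota> ` (pos_part M \<inter> SI)" "g \<longlonglongrightarrow> \<eta>"
    using assms unfolding closure_sequential by blast
  have "norm (f n - g n) \<le> norm (f n + g n)" for n
  proof -
    obtain A B where AB: "f n = \<iota> A" "g n = \<iota> B" "A \<in> pos_part M" "B \<in> pos_part M"
      "A \<in> SI" "B \<in> SI"
      using f(1) g(1) by blast
    have "norm (\<iota> (A - B)) \<le> 1 * norm (\<iota> (A + B))"
      using tr_sq_diff_le_add[OF AB(3,4)] by (intro norm_iota_le SI_intros AB) simp_all
    then show ?thesis by (simp add: AB iota_diff iota_add)
  qed
  then show ?thesis
    by (intro LIMSEQ_le[OF tendsto_norm[OF tendsto_diff[OF f(2) g(2)]]
          tendsto_norm[OF tendsto_add[OF f(2) g(2)]]]) blast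
qed

section \<open>The involution of the completion\<close>

abbreviation J :: "'l \<Rightarrow> 'l" where "J \<equiv> L2_adj M \<rho> \<iota>"

text \<open>By the trace property \<open>X \<mapsto> X\<^sup>*\<close> is isometric for the \<open>L\<^sup>2\<close> norm, so it descends to the dense
  image of \<open>\<iota>\<close> and extends uniquely by uniform continuity.\<close>

lemma L2_adj_characterization:
  "continuous_on UNIV J \<and> (\<forall>X\<in>SI. J (\<iota> X) = \<iota> (op_adj X))"
proof -
  define f where "f \<xi> = \<iota> (op_adj (inv_into SI \<iota> \<xi>))" for \<xi>
  have iso: "norm (\<iota> (op_adj X) - \<iota> (op_adj Y)) = norm (\<iota> X - \<iota> Y)" if "X \<in> SI" "Y \<in> SI" for X Y
    using norm_iota_adj[OF square_integrable_diff[OF that]] that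
    by (simp add: op_adj_algebra M_bounded square_integrable_M iota_diff SI_intros)
  have inv: "inv_into SI \<iota> (\<iota> X) \<in> SI" "\<iota> (inv_into SI \<iota> (\<iota> X)) = \<iota> X" if "X \<in> SI" for X
    using that by (auto intro: inv_into_into f_inv_into_f)
  have f_iota: "f (\<iota> X) = \<iota> (op_adj X)" if "X \<in> SI" for X
    using iso[OF inv(1)[OF that] that] inv(2)[OF that] by (simp add: f_def)
  have "dist (f \<xi>) (f \<eta>) = dist \<xi> \<eta>" if "\<xi> \<in> \<iota> ` SI" "\<eta> \<in> \<iota> ` SI" for \<xi> \<eta>
    using that iso by (auto simp: f_iota dist_norm)
  then have "uniformly_continuous_on (\<iota> ` SI) f"
    unfolding uniformly_continuous_on_def by metis
  from uniformly_continuous_on_extension_on_closure[OF this] obtain g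
    where g: "uniformly_continuous_on (closure (\<iota> ` SI)) g" "\<And>\<xi>. \<xi> \<in> \<iota> ` SI \<Longrightarrow> f \<xi> = g \<xi>"
    by metis
  have g_cont: "continuous_on UNIV g"
    using uniformly_continuous_imp_continuous[OF g(1)] by (simp add: iota_dense)
  have g_iota: "g (\<iota> X) = \<iota> (op_adj X)" if "X \<in> SI" for X
    using that g(2)[of "\<iota> X"] f_iota[of X] by simp
  show ?thesis unfolding L2_adj_def
  proof (rule theI[of _ g])
    show "continuous_on UNIV g \<and> (\<forall>X\<in>SI. g (\<iota> X) = \<iota> (op_adj X))"
      using g_cont g_iota by blast
    fix h assume h: "continuous_on UNIV h \<and> (\<forall>X\<in>SI. h (\<iota> X) = \<iota> (op_adj X))"
    have "h \<xi> = g \<xi>" for \<xi>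
    proof -
      obtain X where X: "\<And>n. X n \<in> SI" "(\<lambda>n. \<iota> (X n)) \<longlonglongrightarrow> \<xi>" using iota_sequence by blast
      have "(\<lambda>n. h (\<iota> (X n))) \<longlonglongrightarrow> h \<xi>" "(\<lambda>n. g (\<iota> (X n))) \<longlonglongrightarrow> g \<xi>"
        using continuous_on_tendsto_compose[of UNIV h, OF _ X(2)]
          continuous_on_tendsto_compose[of UNIV g, OF _ X(2)] h g_cont by simp_all
      moreover have "(\<lambda>n. h (\<iota> (X n))) = (\<lambda>n. g (\<iota> (X n)))"
        using h g_iota X(1) by simp
      ultimately show ?thesis using LIMSEQ_unique by metis
    qed
    then show "h = g" by blast
  qed
qed

lemma L2_adj_iota: "X \<in> SI \<Longrightarrow> J (\<iota> X) = \<iota> (op_adj X)"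
  using L2_adj_characterization by blast

lemma L2_adj_tendsto: "f \<longlonglongrightarrow> \<xi> \<Longrightarrow> (\<lambda>n. J (f n)) \<longlonglongrightarrow> J \<xi>"
  using continuous_on_tendsto_compose[of UNIV J f \<xi> sequentially] L2_adj_characterization by simp

lemma L2_adj_add: "J (\<xi> + \<eta>) = J \<xi> + J \<eta>"
proof -
  obtain X Y where X: "\<And>n. X n \<in> SI" "(\<lambda>n. \<iota> (X n)) \<longlonglongrightarrow> \<xi>"
    and Y: "\<And>n. Y n \<in> SI" "(\<lambda>n. \<iota> (Y n)) \<longlonglongrightarrow> \<eta>"
    using iota_sequence by metis
  have "(\<lambda>n. J (\<iota> (X n) + \<iota> (Y n))) \<longlonglongrightarrow> J (\<xi> + \<eta>)"
    by (intro L2_adj_tendsto tendsto_add X Y)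
  moreover have "J (\<iota> (X n) + \<iota> (Y n)) = J (\<iota> (X n)) + J (\<iota> (Y n))" for n
    using L2_adj_iota[OF square_integrable_add[OF X(1)[of n] Y(1)[of n]]]
    by (simp add: iota_add X(1) Y(1) L2_adj_iota op_adj_algebra M_bounded square_integrable_M SI_intros)
  moreover have "(\<lambda>n. J (\<iota> (X n)) + J (\<iota> (Y n))) \<longlonglongrightarrow> J \<xi> + J \<eta>"
    by (intro L2_adj_tendsto tendsto_add X Y)
  ultimately show ?thesis using LIMSEQ_unique by simp
qed

lemma L2_adj_scaleC: "J (c *\<^sub>C \<xi>) = cnj c *\<^sub>C J \<xi>"
proof -
  obtain X where X: "\<And>n. X n \<in> SI" "(\<lambda>n. \<iota> (X n)) \<longlonglongrightarrow> \<xi>"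
    using iota_sequence by metis
  note scale = bounded_linear.tendsto[OF bounded_linear_scaleC_right]
  have "(\<lambda>n. J (c *\<^sub>C \<iota> (X n))) \<longlonglongrightarrow> J (c *\<^sub>C \<xi>)"
    by (intro L2_adj_tendsto scale X)
  moreover have "J (c *\<^sub>C \<iota> (X n)) = cnj c *\<^sub>C J (\<iota> (X n))" for n
    using L2_adj_iota[OF square_integrable_scaleC[OF X(1)[of n]], of c]
    by (simp add: iota_scaleC X(1) L2_adj_iota op_adj_scale M_bounded square_integrable_M SI_intros)
  moreover have "(\<lambda>n. cnj c *\<^sub>C J (\<iota> (X n))) \<longlonglongrightarrow> cnj c *\<^sub>C J \<xi>"
    by (intro L2_adj_tendsto scale X)
  ultimately show ?thesis using LIMSEQ_unique by simp
qed

lemma L2_adj_positive: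
  assumes "\<xi> \<in> closure (\<iota> ` (pos_part M \<inter> SI))"
  shows "J \<xi> = \<xi>"
proof -
  obtain f where f: "\<forall>n. f n \<in> \<iota> ` (pos_part M \<inter> SI)" "f \<longlonglongrightarrow> \<xi>"
    using assms unfolding closure_sequential by blast
  have "J (f n) = f n" for n
  proof -
    obtain A where "f n = \<iota> A" "A \<in> pos_part M" "A \<in> SI" using f(1) by blast
    then show ?thesis by (simp add: L2_adj_iota pos_part_adj)
  qed
  then have "f \<longlonglongrightarrow> J \<xi>" using L2_adj_tendsto[OF f(2)] by simp
  then show ?thesis using f(2) by (rule LIMSEQ_unique)
qed

end

section \<open>The Cauchy-Schwarz inequality\<close>

text \<open>Optimising \<open>2 t a \<le> p + t\<^sup>2 q\<close> over \<open>t\<close>; the optimal \<open>t\<close> is \<open>a / q\<close>, and for \<open>q = 0\<close>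
  arbitrarily large \<open>t\<close> force \<open>a = 0\<close>.\<close>

lemma square_le_product_of_quadratic:
  fixes a p q :: real
  assumes "0 \<le> a" "0 \<le> p" "0 \<le> q" and bound: "\<And>t. 0 < t \<Longrightarrow> 2 * t * a \<le> p + t\<^sup>2 * q"
  shows "a\<^sup>2 \<le> p * q"
proof (cases "a = 0")
  case True
  then show ?thesis using assms by simp
next
  case False
  then have a: "a > 0" using assms by simp
  show ?thesis
  proof (cases "q = 0")
    case True
    have "2 * ((p + 1) / a) * a \<le> p + ((p + 1) / a)\<^sup>2 * q"
      using a assms by (intro bound) simp
    then show ?thesis using True a assms by simp
  next
    case False
    then have q: "q > 0" using assms by simp
    have "2 * (a / q) * a \<le> p + (a / q)\<^sup>2 * q"
      using a q by (intro bound) simp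
    then show ?thesis using q by (simp add: field_simps power2_eq_square)
  qed
qed

context noncommutative_L2
begin

text \<open>Polarisation over \<open>x + c y\<close> for \<open>c = 1, \<i>\<close>, as the diagonal is fixed by the conjugate linear \<open>J\<close>.\<close>

lemma positive_sesquilinear_hermitian:
  assumes sesq: "sesquilinear \<Phi>" and pos: "\<And>x. L2_pos M \<rho> \<iota> (\<Phi> x x)"
  shows "J (\<Phi> x y) = \<Phi> y x"
proof -
  note S = sesq[unfolded sesquilinear_def]
  have self: "J (\<Phi> z z) = \<Phi> z z" for z by (intro L2_adj_positive L2_pos_closure pos)
  have polar: "c *\<^sub>C J (\<Phi> x y) + cnj c *\<^sub>C J (\<Phi> y x) = cnj c *\<^sub>C \<Phi> x y + c *\<^sub>C \<Phi> y x" for c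
  proof -
    have expand: "\<Phi> (x + c *\<^sub>C y) (x + c *\<^sub>C y)
        = \<Phi> x x + cnj c *\<^sub>C \<Phi> x y + c *\<^sub>C \<Phi> y x + c *\<^sub>C cnj c *\<^sub>C \<Phi> y y"
      using S by (simp add: scaleC_add_right add.assoc scaleC_scaleC mult.commute)
    have J_expand: "J (\<Phi> x x + cnj c *\<^sub>C \<Phi> x y + c *\<^sub>C \<Phi> y x + c *\<^sub>C cnj c *\<^sub>C \<Phi> y y)
        = \<Phi> x x + c *\<^sub>C J (\<Phi> x y) + cnj c *\<^sub>C J (\<Phi> y x) + cnj c *\<^sub>C c *\<^sub>C \<Phi> y y"
      by (simp add: L2_adj_add L2_adj_scaleC self)
    show ?thesis using self[of "x + c *\<^sub>C y"] unfolding expand J_expand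
      by (simp add: scaleC_scaleC mult.commute add.assoc)
  qed
  have sum: "J (\<Phi> x y) + J (\<Phi> y x) = \<Phi> x y + \<Phi> y x"
    using polar[of 1] by (simp add: scaleC_one)
  have "(- \<i>) *\<^sub>C (\<i> *\<^sub>C J (\<Phi> x y) + cnj \<i> *\<^sub>C J (\<Phi> y x))
      = (- \<i>) *\<^sub>C (cnj \<i> *\<^sub>C \<Phi> x y + \<i> *\<^sub>C \<Phi> y x)"
    by (simp only: polar)
  then have diff: "J (\<Phi> x y) - J (\<Phi> y x) = \<Phi> y x - \<Phi> x y"
    by (simp add: scaleC_add_right scaleC_diff_right scaleC_scaleC scaleC_one scaleC_minus_one
        scaleC_minus_left)
  have "2 *\<^sub>R J (\<Phi> x y) = (J (\<Phi> x y) + J (\<Phi> y x)) + (J (\<Phi> x y) - J (\<Phi> y x))"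
    by (simp add: scaleR_2)
  also have "\<dots> = 2 *\<^sub>R \<Phi> y x"
    unfolding sum diff by (simp add: scaleR_2)
  finally show ?thesis by (rule scaleR_left_imp_eq[of 2, rotated]) simp
qed

text \<open>The cross term of \<open>\<Phi>(x \<plusminus> t w y, x \<plusminus> t w y)\<close> is half the difference, and
  \<open>\<Phi>(x, x) + t\<^sup>2 \<Phi>(y, y)\<close> half the sum, of two positive elements.\<close>

lemma cross_term_bound:
  assumes sesq: "sesquilinear \<Phi>" and pos: "\<And>x. L2_pos M \<rho> \<iota> (\<Phi> x x)" and w: "cmod w = 1"
  shows "(norm ((1/2) *\<^sub>C (cnj w *\<^sub>C \<Phi> x y + w *\<^sub>C \<Phi> y x)))\<^sup>2 \<le> norm (\<Phi> x x) * norm (\<Phi> y y)"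
proof (rule square_le_product_of_quadratic)
  note S = sesq[unfolded sesquilinear_def]
  let ?v = "cnj w *\<^sub>C \<Phi> x y + w *\<^sub>C \<Phi> y x"
  fix t :: real assume t: "0 < t"
  define D where "D = \<Phi> x x + t\<^sup>2 *\<^sub>R \<Phi> y y"
  have expand: "\<Phi> (x + (of_real s * w) *\<^sub>C y) (x + (of_real s * w) *\<^sub>C y)
      = \<Phi> x x + s\<^sup>2 *\<^sub>R \<Phi> y y + s *\<^sub>R ?v" for s :: real
  proof -
    have "w * cnj w = 1" using w complex_norm_square[of w] by simp
    then have "of_real s * w * (of_real s * cnj w) = complex_of_real (s\<^sup>2)"
      by (simp add: power2_eq_square ac_simps)
    then show ?thesis
      using S by (simp add: scaleC_add_right scaleR_scaleC scaleC_scaleC ac_simps)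
  qed
  have positive: "D + s *\<^sub>R ?v \<in> closure (\<iota> ` (pos_part M \<inter> SI))" if "s\<^sup>2 = t\<^sup>2" for s
    using L2_pos_closure[OF pos[of "x + (of_real s * w) *\<^sub>C y"]]
    by (simp only: expand that D_def)
  have "norm ((D + t *\<^sub>R ?v) - (D + (- t) *\<^sub>R ?v)) \<le> norm ((D + t *\<^sub>R ?v) + (D + (- t) *\<^sub>R ?v))"
    by (intro norm_diff_le_norm_add positive) simp_all
  also have "(D + t *\<^sub>R ?v) - (D + (- t) *\<^sub>R ?v) = (2 * t) *\<^sub>R ?v"
    by (simp flip: scaleR_left_distrib)
  also have "(D + t *\<^sub>R ?v) + (D + (- t) *\<^sub>R ?v) = 2 *\<^sub>R D" by (simp add: scaleR_2)
  finally have "t * norm ?v \<le> norm D" using t by simp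
  also have "norm D \<le> norm (\<Phi> x x) + t\<^sup>2 * norm (\<Phi> y y)"
    unfolding D_def by (rule order_trans[OF norm_triangle_ineq]) simp
  finally show "2 * t * norm ((1/2) *\<^sub>C ?v) \<le> norm (\<Phi> x x) + t\<^sup>2 * norm (\<Phi> y y)"
    by (simp add: norm_scaleC)
qed simp_all

end

theorem proposition3p3:
  fixes M :: "('h::chilbert_space \<Rightarrow>\<^sub>L 'h) set"
    and \<rho> :: "('h \<Rightarrow>\<^sub>L 'h) \<Rightarrow> ennreal"
    and \<iota> :: "('h \<Rightarrow>\<^sub>L 'h) \<Rightarrow> 'l::{complex_normed_vector, complete_space}"
    and \<Phi> :: "'x::complex_vector \<Rightarrow> 'x \<Rightarrow> 'l"
  assumes "von_neumann_algebra M"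
    and "trace_on M \<rho>" and "faithful_trace M \<rho>" and "normal_trace M \<rho>" and "semifinite_trace M \<rho>"
    and "L2_completion M \<rho> \<iota>"
    and "sesquilinear \<Phi>"
    and "\<And>x. L2_pos M \<rho> \<iota> (\<Phi> x x)"
  shows "(norm (L2_Re M \<rho> \<iota> (\<Phi> x y)))\<^sup>2 \<le> norm (\<Phi> x x) * norm (\<Phi> y y) \<and>
    (norm (L2_Im M \<rho> \<iota> (\<Phi> x y)))\<^sup>2 \<le> norm (\<Phi> x x) * norm (\<Phi> y y)"
proof -
  interpret noncommutative_L2 M \<rho> \<iota>
    by unfold_locales (fact assms)+
  note herm = positive_sesquilinear_hermitian[OF assms(7,8)]
  have re: "L2_Re M \<rho> \<iota> (\<Phi> x y) = (1/2) *\<^sub>C (cnj 1 *\<^sub>C \<Phi> x y + 1 *\<^sub>C \<Phi> y x)"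
    by (simp add: L2_Re_def herm scaleC_one)
  have "(1/2) *\<^sub>C (cnj \<i> *\<^sub>C \<Phi> x y + \<i> *\<^sub>C \<Phi> y x)
      = (1/2 * (- \<i>)) *\<^sub>C (\<Phi> x y - \<Phi> y x)"
    by (simp only: scaleC_scaleC[symmetric])
      (simp add: scaleC_diff_right scaleC_minus_left add.commute)
  moreover have "1/2 * (- \<i>) = 1 / (2 * \<i>)" by (simp add: complex_eq_iff)
  ultimately have im:
    "L2_Im M \<rho> \<iota> (\<Phi> x y) = (1/2) *\<^sub>C (cnj \<i> *\<^sub>C \<Phi> x y + \<i> *\<^sub>C \<Phi> y x)"
    by (simp only: L2_Im_def herm)
  show ?thesis unfolding re im
    by (intro conjI cross_term_bound assms(7,8) norm_one norm_ii)
qed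

end
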